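(* Let $n\ge 2$ and let $\alpha:I\to\mathbb{R}^n$ be a curve, parametrized by arc length, with Frenet frame $\overrightarrow{\mathbf e_1},\dots,\overrightarrow{\mathbf e_n}$ and curvatures $k_1,\dots,k_{n-1}$, all nowhere zero. Then $\alpha$ has constant curvature ratios (i.e. every quotient $k_{i+1}/k_i$, $1\le i\le n-2$, is constant on $I$) if and only if its tangent indicatrix $\overrightarrow{\mathbf e_1}=\alpha':I\to\mathbb{R}^n$ is, up to an isometry of $\mathbb{R}^n$ and up to reparametrization, a twisted geodesic on a flat torus. Explicitly, the latter condition means: writing $k=\lfloor n/2\rfloor$, there exist an orthogonal matrix $A\in O(n)$, real numbers $r_1,\dots,r_k>0$, nonzero real numbers $m_1,\dots,m_k$ with pairwise distinct absolute values, a real constant $a$ (only when $n$ is odd), and a $C^1$ function $g:I\to\mathbb{R}$ with nowhere vanishing derivative such that for all $s\in I$ $$A\,\overrightarrow{\mathbf e_1}(s)=\big(r_1\cos(m_1g(s)),\,r_1\sin(m_1g(s)),\dots,r_k\cos(m_kg(s)),\,r_k\sin(m_kg(s))\big)$$ if $n=2k$, and $$A\,\overrightarrow{\mathbf e_1}(s)=\big(r_1\cos(m_1g(s)),\,r_1\sin(m_1g(s)),\dots,r_k\cos(m_kg(s)),\,r_k\sin(m_kg(s)),\,a\big)$$ if $n=2k+1$.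
   Context: $I\subset\mathbb{R}$ is an open interval. Curves $\alpha:I\to\mathbb{R}^n$ are of class $C^n$ with linearly independent derivatives $\alpha',\alpha'',\dots,\alpha^{(n-1)}$ at each point. The Frenet frame: $\overrightarrow{\mathbf e_1},\dots,\overrightarrow{\mathbf e_{n-1}}$ are obtained by applying the Gram–Schmidt process to $\alpha',\dots,\alpha^{(n-1)}$, and $\overrightarrow{\mathbf e_n}$ is the unit vector making $\{\overrightarrow{\mathbf e_1},\dots,\overrightarrow{\mathbf e_n}\}$ a positively oriented orthonormal basis. The curvatures are $k_i=\langle \dot{\overrightarrow{\mathbf e_i}},\overrightarrow{\mathbf e_{i+1}}\rangle/\|\alpha'\|$, $i=1,\dots,n-1$. The tangent indicatrix of $\alpha$ is the curve $\overrightarrow{\mathbf e_1}$. A flat torus in $\mathbb{R}^{2k}$ is the set of points $(r_1\cos u_1,r_1\sin u_1,\dots,r_k\cos u_k,r_k\sin u_k)$ with $u_i\in\mathbb{R}$; a flat torus in $\mathbb{R}^{2k+1}$ is the set of points $(r_1\cos u_1,r_1\sin u_1,\dots,r_k\cos u_k,r_k\sin u_k,a)$ with $u_i\in\mathbb{R}$ and $a$ a real constant. Its geodesics are the curves obtained by setting $u_i=m_it$ for constants $m_i$; such a geodesic is called twisted when the frequencies $m_i$ are nonzero and have pairwise distinct absolute values. *)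

theory Defs
  imports "HOL-Analysis.Analysis"
begin

text \<open>
  Coordinates of \<^typ>\<open>real ^ 'n\<close> are indexed by a finite linearly ordered type; \<open>pos\<close> numbers
  them \<open>1, \<dots>, CARD('n)\<close> in increasing order. The order fixes the standard orientation.
\<close>

definition pos :: "'n::{finite,linorder} \<Rightarrow> nat"
  where "pos p = card {..p}"

lemma bij_betw_pos: "bij_betw (pos :: 'n::{finite,linorder} \<Rightarrow> nat) UNIV {1..CARD('n)}"
proof -
  have mono: "strict_mono (pos :: 'n \<Rightarrow> nat)"
    unfolding strict_mono_def pos_def by (auto intro!: psubset_card_mono)
  then have inj: "inj (pos :: 'n \<Rightarrow> nat)"
    by (rule strict_mono_imp_inj_on)
  have sub: "range (pos :: 'n \<Rightarrow> nat) \<subseteq> {1..CARD('n)}"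
    by (auto simp: pos_def Suc_le_eq card_gt_0_iff intro!: card_mono[of UNIV, OF finite subset_UNIV])
  have "range (pos :: 'n \<Rightarrow> nat) = {1..CARD('n)}"
    by (rule card_subset_eq[OF _ sub]) (simp_all add: card_image[OF inj])
  with inj show ?thesis by (simp add: bij_betw_def)
qed

definition nth_deriv :: "nat \<Rightarrow> (real \<Rightarrow> 'a::real_normed_vector) \<Rightarrow> real \<Rightarrow> 'a"
  where "nth_deriv j f = ((\<lambda>h t. vector_derivative h (at t)) ^^ j) f"

text \<open>Meant for open \<open>S\<close>: the derivatives are two-sided.\<close>

definition C_n_on :: "nat \<Rightarrow> (real \<Rightarrow> 'a::real_normed_vector) \<Rightarrow> real set \<Rightarrow> bool"
  where "C_n_on n f S \<longleftrightarrow>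
    (\<forall>j<n. \<forall>t\<in>S. nth_deriv j f differentiable (at t)) \<and> continuous_on S (nth_deriv n f)"

text \<open>Injectivity is needed because \<^const>\<open>independent\<close> is about the set of derivatives, not the family.\<close>

definition regular_curve :: "real set \<Rightarrow> (real \<Rightarrow> real ^ 'n) \<Rightarrow> bool"
  where "regular_curve I \<alpha> \<longleftrightarrow>
    C_n_on CARD('n) \<alpha> I \<and>
    (\<forall>s\<in>I. inj_on (\<lambda>j. nth_deriv j \<alpha> s) {1..<CARD('n)} \<and>
            independent ((\<lambda>j. nth_deriv j \<alpha> s) ` {1..<CARD('n)}))"

text \<open>Indices start at 1; \<^term>\<open>sgn w\<close> is the normalized vector \<^term>\<open>w /\<^sub>R norm w\<close>.\<close>

function gram_schmidt :: "(nat \<Rightarrow> 'a::real_inner) \<Rightarrow> nat \<Rightarrow> 'a" where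
  "gram_schmidt v i =
    sgn (v i - (\<Sum>j\<in>{1..<i}. (v i \<bullet> gram_schmidt v j) *\<^sub>R gram_schmidt v j))"
  by pat_completeness auto
termination
  by (relation "inv_image less_than snd") auto

declare gram_schmidt.simps [simp del]

lemma gram_schmidt_orthonormal:
  fixes v :: "nat \<Rightarrow> 'a::euclidean_space"
  assumes "inj_on v {1..<n}" and "independent (v ` {1..<n})" and "m \<le> n"
  shows "(\<forall>i\<in>{1..<m}. \<forall>j\<in>{1..<m}. gram_schmidt v i \<bullet> gram_schmidt v j = (if i = j then 1 else 0)) \<and>
    span (gram_schmidt v ` {1..<m}) = span (v ` {1..<m})"
  using assms(3)
proof (induction m)
  case 0
  then show ?case by simp
next
  case (Suc m)
  let ?g = "gram_schmidt v"
  show ?case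
  proof (cases "m = 0")
    case True
    then show ?thesis by simp
  next
    case False
    then have set: "{1..<Suc m} = insert m {1..<m}" by auto
    have on: "\<And>i j. i\<in>{1..<m} \<Longrightarrow> j\<in>{1..<m} \<Longrightarrow> ?g i \<bullet> ?g j = (if i = j then 1 else 0)"
      and sp: "span (?g ` {1..<m}) = span (v ` {1..<m})"
      using Suc by auto
    define p where "p = (\<Sum>j\<in>{1..<m}. (v m \<bullet> ?g j) *\<^sub>R ?g j)"
    define w where "w = v m - p"
    have gm: "?g m = sgn w"
      by (subst gram_schmidt.simps) (simp add: w_def p_def)
    have pspan: "p \<in> span (?g ` {1..<m})"
      unfolding p_def by (intro span_sum span_scale span_base imageI)
    have "v m \<notin> span (v ` {1..<m})"
    proof -
      have "m \<in> {1..<n}" using Suc.prems False by simp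
      then have "v m \<notin> span (v ` {1..<n} - {v m})"
        using assms(2) unfolding dependent_def by blast
      moreover have "v ` {1..<m} \<subseteq> v ` {1..<n} - {v m}"
        proof clarify
        fix i assume i: "i \<in> {1..<m}"
        then have "v i \<noteq> v m" using inj_onD[OF assms(1), of i m] Suc.prems by auto
        then show "v i \<in> v ` {1..<n} - {v m}" using i Suc.prems by auto
      qed
      ultimately show ?thesis using span_mono by blast
    qed
    then have w0: "w \<noteq> 0" using pspan sp by (auto simp: w_def)
    have wo: "w \<bullet> ?g i = 0" if i: "i \<in> {1..<m}" for i
    proof -
      have "p \<bullet> ?g i = (\<Sum>j\<in>{1..<m}. (v m \<bullet> ?g j) * (if j = i then 1 else 0))"
        unfolding p_def inner_sum_left using i by (intro sum.cong) (simp_all add: on)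
      also have "\<dots> = v m \<bullet> ?g i" using i by (simp add: if_distrib cong: if_cong)
      finally show ?thesis by (simp add: w_def inner_diff_left)
    qed
    have o1: "?g m \<bullet> ?g i = 0" if "i \<in> {1..<m}" for i
      using wo[OF that] by (simp add: gm sgn_div_norm)
    have o2: "?g m \<bullet> ?g m = 1"
      using w0 by (simp add: gm dot_square_norm norm_sgn)
    have "span (insert (?g m) (?g ` {1..<m})) = span (insert (v m) (v ` {1..<m}))"
    proof -
      have "span (insert (?g m) (?g ` {1..<m})) = span (insert w (?g ` {1..<m}))"
      proof (rule span_eq[THEN iffD2], intro conjI insert_subsetI)
        show "?g m \<in> span (insert w (?g ` {1..<m}))"
          unfolding gm sgn_div_norm by (intro span_scale span_base) simp
        have "w = norm w *\<^sub>R ?g m" using w0 by (simp add: gm sgn_div_norm)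
        then show "w \<in> span (insert (?g m) (?g ` {1..<m}))"
          by (metis insertI1 span_base span_scale)
      qed (auto intro: span_base)
      also have "\<dots> = span (insert (v m) (?g ` {1..<m}))"
      proof (rule span_eq[THEN iffD2], intro conjI insert_subsetI)
        have ps: "p \<in> span (insert x (?g ` {1..<m}))" for x
          using pspan span_mono[of "?g ` {1..<m}" "insert x (?g ` {1..<m})"] by blast
        show "w \<in> span (insert (v m) (?g ` {1..<m}))"
          unfolding w_def by (intro span_diff ps span_base) simp
        have "v m = w + p" by (simp add: w_def)
        then show "v m \<in> span (insert w (?g ` {1..<m}))"
          by (metis insertI1 ps span_add span_base)
      qed (auto intro: span_base)
      also have "\<dots> = span (insert (v m) (v ` {1..<m}))"
        by (simp only: span_insert sp)
      finally show ?thesis .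
    qed
    then show ?thesis
    proof -
      have o3: "?g i \<bullet> ?g m = 0" if "i \<in> {1..<m}" for i
        using o1[OF that] by (simp only: inner_commute)
      have "?g i \<bullet> ?g j = (if i = j then 1 else 0)"
        if "i \<in> insert m {1..<m}" "j \<in> insert m {1..<m}" for i j
      proof (cases "i = m")
        case True
        then show ?thesis using that(2) o1[of j] o2 by (cases "j = m") simp_all
      next
        case False
        then have i: "i \<in> {1..<m}" using that(1) by blast
        show ?thesis
        proof (cases "j = m")
          case True
          then show ?thesis using o3[OF i] False by simp
        next
          case False
          then have "j \<in> {1..<m}" using that(2) by blast
          then show ?thesis by (rule on[OF i])
        qed
      qed
      moreover assume "span (insert (?g m) (?g ` {1..<m})) = span (insert (v m) (v ` {1..<m}))"
      ultimately show ?thesis unfolding set image_insert by blast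
    qed
  qed
qed

definition positive_onb :: "(nat \<Rightarrow> real ^ 'n::{finite,linorder}) \<Rightarrow> bool"
  where "positive_onb b \<longleftrightarrow>
    (\<forall>i\<in>{1..CARD('n)}. \<forall>j\<in>{1..CARD('n)}. b i \<bullet> b j = (if i = j then 1 else 0)) \<and>
    det (\<chi> p q. b (pos q) $ p) > 0"

lemma ex1_positive_onb:
  fixes b :: "nat \<Rightarrow> real ^ 'n::{finite,linorder}"
  assumes on: "\<And>i j. i \<in> {1..<CARD('n)} \<Longrightarrow> j \<in> {1..<CARD('n)} \<Longrightarrow> b i \<bullet> b j = (if i = j then 1 else 0)"
  shows "\<exists>!v. positive_onb (b(CARD('n) := v))"
proof -
  let ?n = "CARD('n)"
  let ?O = "\<lambda>v. v \<bullet> v = 1 \<and> (\<forall>i\<in>{1..<?n}. v \<bullet> b i = 0)"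
  define M :: "(real,'n) vec \<Rightarrow> ((real,'n) vec,'n) vec" where "M v = (\<chi> p q. (b(?n := v)) (pos q) $ p)" for v
  have "?n \<in> range (pos :: 'n \<Rightarrow> nat)"
    unfolding bij_betw_imp_surj_on[OF bij_betw_pos] by (simp add: Suc_le_eq)
  then obtain z :: 'n where z: "pos z = ?n" by (metis rangeE)
  have posr: "pos (q::'n) \<in> {1..?n}" for q
    using bij_betw_pos[where 'n='n] by (auto simp: bij_betw_def)
  have posi: "pos (p::'n) = pos q \<longleftrightarrow> p = q" for p q
    using bij_betw_pos[where 'n='n] by (auto simp: bij_betw_def inj_eq)
  have n1: "?n \<ge> 1" by (simp add: Suc_le_eq)
  have onb: "(\<forall>i\<in>{1..?n}. \<forall>j\<in>{1..?n}. (b(?n := v)) i \<bullet> (b(?n := v)) j = (if i = j then 1 else 0)) \<longleftrightarrow> ?O v" for v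
  proof -
    have "{1..?n} = insert ?n {1..<?n}" using n1 by auto
    then show ?thesis using on by (auto simp: inner_commute)
  qed
  have key: "positive_onb (b(?n := v)) \<longleftrightarrow> ?O v \<and> det (M v) > 0" for v
    unfolding positive_onb_def onb M_def ..
  have orth: "orthogonal_matrix (M v)" if "?O v" for v
  proof -
    have *: "(b(?n := v)) (pos p) \<bullet> (b(?n := v)) (pos q) = (if p = q then 1 else 0)" for p q :: 'n
      using onb[of v, THEN iffD2, OF that] posr posi by metis
    have "transpose (M v) ** M v = mat 1"
      using * by (simp add: vec_eq_iff matrix_matrix_mult_def transpose_def mat_def M_def inner_vec_def)
    then show ?thesis by (simp add: orthogonal_matrix)
  qed
  have neg: "det (M (- v)) = - det (M v)" for v
  proof -
    have a: "transpose (M v) = (\<chi> q. if q = z then v else b (pos q))" for v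
    proof -
      have "pos q = ?n \<longleftrightarrow> q = z" for q :: 'n using z posi[of q z] by simp
      then show ?thesis by (simp add: vec_eq_iff transpose_def M_def)
    qed
    have "det (transpose (M (-v))) = det (\<chi> q. if q = z then (-1) *s v else b (pos q))"
      unfolding a by (simp only: vector_sneg_minus1)
    also have "\<dots> = - det (transpose (M v))"
      unfolding a by (subst det_row_mul) simp
    finally show ?thesis by (simp add: det_transpose)
  qed
  have dim: "dim (b ` {1..<?n}) < ?n"
  proof -
    have "dim (b ` {1..<?n}) \<le> ?n - 1"
      using dim_le_card'[of "b ` {1..<?n}"] card_image_le[of "{1..<?n}" b] by simp
    then show ?thesis using n1 by linarith
  qed
  obtain u where u0: "u \<noteq> 0" "\<And>y. y \<in> span (b ` {1..<?n}) \<Longrightarrow> orthogonal u y"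
    using orthogonal_to_subspace_exists[of "b ` {1..<?n}"] dim by auto
  define w where "w = sgn u"
  have wO: "?O w"
  proof (intro conjI ballI)
    show "w \<bullet> w = 1" using u0(1) by (simp add: w_def dot_square_norm norm_sgn)
    fix i assume "i \<in> {1..<?n}"
    then have "u \<bullet> b i = 0" using u0(2)[of "b i"] by (simp add: span_base orthogonal_def)
    then show "w \<bullet> b i = 0" by (simp add: w_def sgn_div_norm)
  qed
  have d: "det (M w) = 1 \<or> det (M w) = -1"
    using det_orthogonal_matrix[OF orth[OF wO]] .
  obtain v where v: "?O v" "det (M v) > 0"
  proof (cases "det (M w) = 1")
    case True
    then show ?thesis using that[of w] wO by simp
  next
    case False
    then show ?thesis using that[of "- w"] wO d neg[of w] by simp
  qed
  have "v' = v" if v': "?O v'" "det (M v') > 0" for v'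
  proof -
    define x where "x = v' - (v' \<bullet> v) *\<^sub>R v"
    have "x \<bullet> (b(?n := v)) i = 0" if "i \<in> {1..?n}" for i
      using that v v' by (cases "i = ?n") (auto simp: x_def inner_diff_left)
    then have "x v* M v = 0"
      using posr by (simp add: vec_eq_iff vector_matrix_mult_def M_def inner_vec_def mult.commute)
    then have "x = 0"
    proof -
      assume x0: "x v* M v = 0"
      have "x = x v* (M v ** transpose (M v))"
        using orth[OF v(1)] by (simp add: orthogonal_matrix_def)
      also have "\<dots> = (x v* M v) v* transpose (M v)" by (simp only: vector_matrix_mul_assoc)
      finally show "x = 0" using x0 by simp
    qed
    then have e: "v' = (v' \<bullet> v) *\<^sub>R v" by (simp add: x_def)
    have "v' \<bullet> v' = v' \<bullet> ((v' \<bullet> v) *\<^sub>R v)" using arg_cong[OF e, of "\<lambda>y. v' \<bullet> y"] .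
    then have "(v' \<bullet> v)\<^sup>2 = 1" using v'(1) by (simp add: power2_eq_square)
    then have "v' = v \<or> v' = - v" using e by (metis power2_eq_1_iff scaleR_one scaleR_minus1_left)
    then show ?thesis
    proof
      assume "v' = - v"
      then show ?thesis using neg[of v] v(2) v'(2) by simp
    qed
  qed
  note uniq = this
  show ?thesis
  proof (rule ex1I[of _ v])
    show "positive_onb (b(?n := v))" using v key[of v] by blast
    fix v' assume "positive_onb (b(?n := v'))"
    then have "?O v'" "det (M v') > 0" using key[of v'] by blast+
    then show "v' = v" by (rule uniq)
  qed
qed

definition frenet_frame :: "(real \<Rightarrow> real ^ 'n::{finite,linorder}) \<Rightarrow> nat \<Rightarrow> real \<Rightarrow> real ^ 'n::{finite,linorder}"
  where "frenet_frame \<alpha> i s =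
    (let e = gram_schmidt (\<lambda>j. nth_deriv j \<alpha> s) in
     if i < CARD('n) then e i else (THE v. positive_onb (e(CARD('n) := v))))"

lemma frenet_frame_positive_onb:
  fixes \<alpha> :: "real \<Rightarrow> real ^ 'n::{finite,linorder}"
  assumes "regular_curve I \<alpha>" and "s \<in> I"
  shows "positive_onb (\<lambda>i. frenet_frame \<alpha> i s)"
proof -
  let ?e = "gram_schmidt (\<lambda>j. nth_deriv j \<alpha> s)"
  let ?f = "?e(CARD('n) := THE v. positive_onb (?e(CARD('n) := v)))"
  have ind: "inj_on (\<lambda>j. nth_deriv j \<alpha> s) {1..<CARD('n)}"
    "independent ((\<lambda>j. nth_deriv j \<alpha> s) ` {1..<CARD('n)})"
    using assms by (simp_all add: regular_curve_def)
  have "\<exists>!v. positive_onb (?e(CARD('n) := v))"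
    using gram_schmidt_orthonormal[OF ind order_refl, THEN conjunct1]
    by (intro ex1_positive_onb) simp
  then have "positive_onb ?f"
    by (rule theI')
  moreover have "frenet_frame \<alpha> i s = ?f i" if "i \<in> {1..CARD('n)}" for i
    using that by (simp add: frenet_frame_def Let_def)
  moreover have "pos (q::'n) \<in> {1..CARD('n)}" for q
    using bij_betw_pos[where 'n='n] by (auto simp: bij_betw_def)
  ultimately show ?thesis by (simp only: positive_onb_def simp_thms ball_triv cong: ball_cong)
qed

definition curvature :: "(real \<Rightarrow> real ^ 'n::{finite,linorder}) \<Rightarrow> nat \<Rightarrow> real \<Rightarrow> real"
  where "curvature \<alpha> i s =
    (vector_derivative (frenet_frame \<alpha> i) (at s) \<bullet> frenet_frame \<alpha> (i + 1) s)
      / norm (vector_derivative \<alpha> (at s))"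

text \<open>
  The point of a flat torus with angles \<open>u 1, \<dots>, u k\<close>, where \<open>k = CARD('n) div 2\<close>: coordinates
  number \<open>2 * i - 1\<close> and \<open>2 * i\<close> are \<open>r i * cos (u i)\<close> and \<open>r i * sin (u i)\<close>. The constant \<open>a\<close>
  is the last coordinate in odd dimension and is not used in even dimension.
\<close>

definition flat_torus_point :: "(nat \<Rightarrow> real) \<Rightarrow> real \<Rightarrow> (nat \<Rightarrow> real) \<Rightarrow> real ^ 'n::{finite,linorder}"
  where "flat_torus_point r a u =
    (\<chi> p. if odd (pos p) then
              (if pos p = CARD('n) then a
               else r ((pos p + 1) div 2) * cos (u ((pos p + 1) div 2)))
            else r (pos p div 2) * sin (u (pos p div 2)))"

definition flat_torus_geodesic ::
    "(nat \<Rightarrow> real) \<Rightarrow> real \<Rightarrow> (nat \<Rightarrow> real) \<Rightarrow> real \<Rightarrow> real ^ 'n::{finite,linorder}"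
  where "flat_torus_geodesic r a m t = flat_torus_point r a (\<lambda>i. m i * t)"

definition twisted :: "nat \<Rightarrow> (nat \<Rightarrow> real) \<Rightarrow> bool"
  where "twisted k m \<longleftrightarrow> (\<forall>i\<in>{1..k}. m i \<noteq> 0) \<and> inj_on (\<lambda>i. \<bar>m i\<bar>) {1..k}"

end

(*
  In arc length the tangent e_1 of a curve whose curvatures are k_i = c_i k_1 solves e_1' = k_1 B e_1,
  where B maps e_i to c_i e_(i+1) - c_(i-1) e_(i-1). In the moving frame B is a constant
  skew-symmetric tridiagonal matrix, and differentiating shows that it is constant as an endomorphism
  of R^n as well. As the c_i do not vanish, e_1 is a cyclic vector of B, so the rotation planes of B
  have distinct speeds, its kernel has dimension at most one, and e_1 has a nonzero component in each
  of these spaces: in adapted coordinates, with g an antiderivative of k_1, the curve e_1 is a twisted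
  geodesic of a flat torus. Conversely, such a geodesic satisfies e_1' = g' B e_1 with B
  skew-symmetric; inductively e_i = Q_i e_1 with Q_i linear and commuting with B, and k_i / g' is
  continuous of constant absolute value, hence constant.
*)

theory Submission
  imports Defs
begin

section \<open>Skew-symmetric maps with a cyclic vector\<close>

text \<open>In the fixed space R^n the map B does not change because all frame vectors obey the same
  equation e_i' = k_1 B e_i: differentiating B, written in the moving frame, gives k_1 times the
  commutator of B with itself. Its rotation planes come from maximizing |B w|^2 on the unit spheres
  of successive invariant complements. In each plane the basis is turned so that its first vector
  points along the projection of the initial tangent; with g vanishing at the initial parameter, all
  phases of the geodesic are then zero. Regularity shapes the other half. The abstract Frenet system
  assumes continuity of k_1 alone, so no curvature and no quotient of curvatures is ever
  differentiated. Constancy comes from lengths instead: a vector L e_1 with L linear and commuting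
  with B solves the same linear equation as e_1 and so keeps its norm, which fixes k_i / g' up to
  sign. The last frame vector, defined by orthogonality and orientation and not by a derivative of
  the curve, owes its differentiability to a determinant formula.\<close>

lemma orthonormal_expand:
  fixes b :: "nat \<Rightarrow> 'a::euclidean_space"
  assumes on: "\<And>i j. i \<in> {1..DIM('a)} \<Longrightarrow> j \<in> {1..DIM('a)} \<Longrightarrow> b i \<bullet> b j = (if i = j then 1 else 0)"
  shows "(\<Sum>i=1..DIM('a). (w \<bullet> b i) *\<^sub>R b i) = w"
proof -
  let ?B = "b ` {1..DIM('a)}"
  have inj: "inj_on b {1..DIM('a)}"
  proof (rule inj_onI)
    fix i j assume "i \<in> {1..DIM('a)}" "j \<in> {1..DIM('a)}" "b i = b j"
    then show "i = j" using on[of i j] on[of i i] by (metis zero_neq_one)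
  qed
  have orth: "pairwise orthogonal ?B"
    using on by (auto simp: pairwise_def orthogonal_def)
  moreover have "0 \<notin> ?B"
    using on by (metis imageE inner_zero_left zero_neq_one)
  ultimately have "independent ?B"
    by (rule pairwise_orthogonal_independent)
  moreover have "card ?B = DIM('a)"
    using card_image[OF inj] by simp
  ultimately have "w \<in> span ?B"
    using card_ge_dim_independent[of ?B UNIV] by (auto simp: dim_UNIV)
  then have "(\<Sum>i\<in>?B. (w \<bullet> i) *\<^sub>R i) = w"
    using on by (intro orthonormal_basis_expand[OF orth]) (auto simp: norm_eq_sqrt_inner)
  then show ?thesis
    unfolding sum.reindex[OF inj] o_def .
qed

lemma orthonormal_eq_0:
  fixes b :: "nat \<Rightarrow> 'a::euclidean_space"
  assumes "\<And>i j. i \<in> {1..DIM('a)} \<Longrightarrow> j \<in> {1..DIM('a)} \<Longrightarrow> b i \<bullet> b j = (if i = j then 1 else 0)"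
    and "\<And>i. i \<in> {1..DIM('a)} \<Longrightarrow> w \<bullet> b i = 0"
  shows "w = 0"
proof -
  have "w = (\<Sum>i=1..DIM('a). (w \<bullet> b i) *\<^sub>R b i)"
    by (rule orthonormal_expand[of b w, OF assms(1), symmetric])
  also have "\<dots> = 0" using assms(2) by (intro sum.neutral) simp
  finally show ?thesis .
qed

section \<open>Rotation planes aligned with the cyclic vector\<close>

text \<open>
  The condition \<open>cyclic\<close> is what remains of the cyclicity of \<open>v\<close> on an eigenspace of \<open>B\<^sup>2\<close>, where
  all iterates \<open>B^j v\<close> act, as functionals, like multiples of \<open>v\<close> and \<open>B v\<close>.
\<close>

locale skew_cyclic =
  fixes B :: "'a::euclidean_space \<Rightarrow> 'a" and v :: 'a
  assumes lin: "linear B"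
    and skew: "\<And>x y. B x \<bullet> y = - (x \<bullet> B y)"
    and cyclic: "\<And>w l. B (B w) = l *\<^sub>R w \<Longrightarrow> w \<bullet> v = 0 \<Longrightarrow> w \<bullet> B v = 0 \<Longrightarrow> w = 0"
begin

lemma skew_self: "x \<bullet> B x = 0"
  using skew[of x x] by (simp add: inner_commute)

text \<open>Each plane carries a basis adapted to \<open>v\<close> as well as to \<open>B\<close>:
  \<open>x i\<close> is the direction of the projection of \<open>v\<close> to the plane, whence
  \<open>r i > 0\<close> and no component along \<open>y i\<close>. The speed \<open>m i\<close> is
  made positive by the choice of \<open>y i\<close>.\<close>

definition rotation_planes ::
    "nat \<Rightarrow> (nat \<Rightarrow> 'a) \<Rightarrow> (nat \<Rightarrow> 'a) \<Rightarrow> (nat \<Rightarrow> real) \<Rightarrow> (nat \<Rightarrow> real) \<Rightarrow> bool"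
  where "rotation_planes p x y m r \<longleftrightarrow>
    (\<forall>i\<in>{1..p}. \<forall>j\<in>{1..p}. x i \<bullet> x j = (if i = j then 1 else 0) \<and>
      y i \<bullet> y j = (if i = j then 1 else 0) \<and> x i \<bullet> y j = 0) \<and>
    (\<forall>i\<in>{1..p}. m i > 0 \<and> r i > 0 \<and> B (x i) = m i *\<^sub>R y i \<and> B (y i) = (- m i) *\<^sub>R x i \<and>
      v \<bullet> x i = r i \<and> v \<bullet> y i = 0) \<and>
    inj_on m {1..p}"

text \<open>The planes are invariant under \<open>B\<close>, and skew-symmetry passes invariance on
  to the orthogonal complement.\<close>

lemma rotation_planes_complement_invariant:
  assumes "rotation_planes p x y m r"
    and "\<And>i. i \<in> {1..p} \<Longrightarrow> w \<bullet> x i = 0 \<and> w \<bullet> y i = 0" and "i \<in> {1..p}"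
  shows "B w \<bullet> x i = 0 \<and> B w \<bullet> y i = 0"
  using assms(1) assms(2,3) by (simp add: skew rotation_planes_def)

text \<open>A maximizer \<open>u\<close> of |B w|^2 on the unit sphere of the complement
  \<open>V\<close> is an eigenvector of the square of \<open>B\<close>, so \<open>u\<close> and
  \<open>B u\<close> span a new plane. The condition \<open>cyclic\<close> is used three times: for
  a positive maximum, for a nonzero projection of \<open>v\<close> to the plane, and for a speed
  different from the old ones.\<close>

lemma rotation_planes_extend:
  assumes P: "rotation_planes p x y m r" and dim: "2 * p + 2 \<le> DIM('a)"
  shows "\<exists>x y m r. rotation_planes (Suc p) x y m r"
proof -
  define V where "V = {w. \<forall>i\<in>{1..p}. w \<bullet> x i = 0 \<and> w \<bullet> y i = 0}"
  have sub: "subspace V"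
    by (auto simp: V_def subspace_def inner_add_left)
  have inv: "B w \<in> V" if "w \<in> V" for w
    using rotation_planes_complement_invariant[OF P] that by (auto simp: V_def)
  have clV: "closed V"
    by (rule closed_subspace[OF sub])
  \<comment> \<open>The \<open>2 * p + 1\<close> vectors in \<open>?S\<close> cannot span the space.
    A vector \<open>w0\<close> orthogonal to them lies outside the kernel of \<open>B\<close>, by
    \<open>cyclic\<close> with \<open>l = 0\<close>, so the maximum below is positive.\<close>
  obtain w0 where w0: "w0 \<in> V" "w0 \<bullet> v = 0" "w0 \<noteq> 0"
  proof -
    let ?S = "insert v (x ` {1..p} \<union> y ` {1..p})"
    have "card ?S \<le> Suc (card (x ` {1..p} \<union> y ` {1..p}))"
      by (rule card_insert_le_m1[OF zero_less_Suc]) simp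
    also have "\<dots> \<le> Suc (card (x ` {1..p}) + card (y ` {1..p}))"
      using card_Un_le by blast
    also have "\<dots> \<le> Suc (p + p)"
      using card_image_le[of "{1..p}" x] card_image_le[of "{1..p}" y] by simp
    also have "\<dots> < DIM('a)" using dim by simp
    finally have "dim ?S < DIM('a)"
      using dim_le_card'[of ?S] by simp
    then obtain u where u: "u \<noteq> 0" "\<And>z. z \<in> span ?S \<Longrightarrow> orthogonal u z"
      using orthogonal_to_subspace_exists[of ?S] by auto
    have "u \<bullet> z = 0" if "z \<in> ?S" for z
      using u(2)[of z] that by (simp add: span_base orthogonal_def)
    then show ?thesis using u(1) by (intro that[of u]) (auto simp: V_def)
  qed
  have Bw0: "B w0 \<noteq> 0"
  proof
    assume "B w0 = 0"
    then have "B (B w0) = 0 *\<^sub>R w0" "w0 \<bullet> B v = 0"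
      using skew[of w0 v] linear_0[OF lin] by auto
    then show False using cyclic w0 by blast
  qed
  define \<Sigma> where "\<Sigma> = V \<inter> sphere 0 1"
  have "sgn w0 \<in> \<Sigma>"
    using w0 sub by (simp add: \<Sigma>_def norm_sgn sgn_div_norm subspace_mul)
  then have "\<Sigma> \<noteq> {}" by blast
  moreover have "compact \<Sigma>"
    unfolding \<Sigma>_def using clV by (intro closed_Int_compact) auto
  moreover have "continuous_on \<Sigma> (\<lambda>w. B w \<bullet> B w)"
    using linear_continuous_on[OF lin[unfolded linear_conv_bounded_linear]]
    by (intro continuous_intros) auto
  ultimately obtain u where u: "u \<in> \<Sigma>" and max: "\<And>w. w \<in> \<Sigma> \<Longrightarrow> B w \<bullet> B w \<le> B u \<bullet> B u"
    using continuous_attains_sup[of \<Sigma> "\<lambda>w. B w \<bullet> B w"] by blast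
  define \<mu> where "\<mu> = B u \<bullet> B u"
  have uV: "u \<in> V" and u1: "u \<bullet> u = 1"
    using u by (auto simp: \<Sigma>_def norm_eq_1)
  have max': "B w \<bullet> B w \<le> \<mu> * (w \<bullet> w)" if "w \<in> V" for w
  proof (cases "w = 0")
    case True
    then show ?thesis using linear_0[OF lin] by simp
  next
    case False
    then have "B (sgn w) \<bullet> B (sgn w) \<le> \<mu>"
      using max[of "sgn w"] that sub by (simp add: \<mu>_def \<Sigma>_def norm_sgn sgn_div_norm subspace_mul)
    then have "(B w \<bullet> B w) / (norm w * norm w) \<le> \<mu>"
      by (simp add: sgn_div_norm linear_scale[OF lin] divide_inverse mult_ac)
    then show ?thesis
      using False by (simp add: dot_square_norm power2_eq_square pos_divide_le_eq)
  qed
  have \<mu>: "\<mu> > 0"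
  proof (rule ccontr)
    assume "\<not> \<mu> > 0"
    then have "\<mu> * (w0 \<bullet> w0) \<le> 0" by (simp add: mult_nonpos_nonneg)
    then have "B w0 \<bullet> B w0 \<le> 0" using max'[OF w0(1)] by linarith
    then have "B w0 \<bullet> B w0 = 0" using inner_ge_zero[of "B w0"] by linarith
    then show False using Bw0 by simp
  qed
  \<comment> \<open>First variation at the maximizer: the defect \<mu> |u + t w|^2 - |B (u + t w)|^2
    is nonnegative and vanishes at t = 0, so its linear coefficient 2 \<beta> must vanish.\<close>
  have stationary: "\<mu> * (u \<bullet> w) = B u \<bullet> B w" if w: "w \<in> V" for w
  proof -
    define \<beta> where "\<beta> = \<mu> * (u \<bullet> w) - B u \<bullet> B w"
    define q where "q = \<mu> * (w \<bullet> w) - B w \<bullet> B w"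
    have q0: "q \<ge> 0" using max'[OF w] by (simp add: q_def)
    have ineq: "0 \<le> 2 * t * \<beta> + t\<^sup>2 * q" for t
    proof -
      have "u + t *\<^sub>R w \<in> V" using sub uV w by (intro subspace_add subspace_mul)
      from max'[OF this] show ?thesis
        using u1 by (simp add: linear_add[OF lin] linear_scale[OF lin] inner_add_left inner_add_right
          \<beta>_def q_def algebra_simps power2_eq_square inner_commute \<mu>_def[symmetric])
    qed
    have "\<beta> = 0"
    proof (rule ccontr)
      assume b: "\<beta> \<noteq> 0"
      \<comment> \<open>This value turns the quadratic into - t^2 (q + 2); the summand 1 keeps the
        denominator positive when \<open>q = 0\<close>.\<close>
      define t where "t = - \<beta> / (q + 1)"
      have t: "\<beta> = - t * (q + 1)" "t \<noteq> 0" using b q0 by (simp_all add: t_def)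
      have "0 \<le> 2 * t * \<beta> + t\<^sup>2 * q" by (rule ineq)
      also have "\<dots> = - (t\<^sup>2 * (q + 2))"
        unfolding t(1) by (simp add: algebra_simps power2_eq_square)
      also have "\<dots> < 0"
        using t(2) q0 by simp
      finally show False by simp
    qed
    then show ?thesis by (simp add: \<beta>_def)
  qed
  \<comment> \<open>By \<open>stationary\<close> and skew-symmetry \<open>z\<close> is orthogonal to
    all of \<open>V\<close>, while it lies in \<open>V\<close> itself.\<close>
  have BBu: "B (B u) = (- \<mu>) *\<^sub>R u"
  proof -
    define z where "z = B (B u) + \<mu> *\<^sub>R u"
    have "z \<in> V" unfolding z_def using inv uV sub by (intro subspace_add subspace_mul) auto
    then have "z \<bullet> z = 0"
      using stationary[of z] skew[of "B u" z] by (simp add: z_def inner_add_left)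
    then show ?thesis by (simp add: z_def eq_neg_iff_add_eq_0)
  qed
  \<comment> \<open>The orthogonal projection of \<open>v\<close> to the plane of \<open>u\<close>
    and \<open>B u\<close>; these are orthogonal, with squared norms 1 and \<mu>.\<close>
  define c where "c = (u \<bullet> v) *\<^sub>R u + ((B u \<bullet> v) / \<mu>) *\<^sub>R B u"
  have cV: "c \<in> V" unfolding c_def using inv uV sub by (intro subspace_add subspace_mul) auto
  have Bc: "B c = (u \<bullet> v) *\<^sub>R B u - (B u \<bullet> v) *\<^sub>R u"
    using \<mu> by (simp add: c_def linear_add[OF lin] linear_scale[OF lin] BBu)
  have BBc: "B (B c) = (- \<mu>) *\<^sub>R c"
    using \<mu> by (simp add: Bc linear_diff[OF lin] linear_scale[OF lin] BBu) (simp add: c_def algebra_simps)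
  have Bcv: "B c \<bullet> v = 0"
    by (simp add: Bc inner_diff_left)
  have cv: "c \<bullet> v = c \<bullet> c"
    using u1 skew_self[of u] \<mu>
    by (simp add: c_def inner_add_left inner_add_right inner_commute \<mu>_def[symmetric])
  \<comment> \<open>A zero projection would make \<open>u\<close> orthogonal to both
    \<open>v\<close> and \<open>B v\<close>, and \<open>cyclic\<close> would annihilate
    \<open>u\<close>.\<close>
  have c0: "c \<noteq> 0"
  proof
    assume "c = 0"
    then have "c \<bullet> v = 0" by simp
    then have "(u \<bullet> v)\<^sup>2 + (B u \<bullet> v)\<^sup>2 / \<mu> = 0"
      by (simp add: c_def inner_add_left power2_eq_square)
    then have "u \<bullet> v = 0" "B u \<bullet> v = 0"
      using \<mu> by (simp_all add: add_nonneg_eq_0_iff)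
    then have "u = 0" using cyclic[OF BBu] by (simp add: skew)
    then show False using u1 by simp
  qed
  define \<rho> where "\<rho> = norm c"
  define x0 where "x0 = c /\<^sub>R \<rho>"
  define m0 where "m0 = sqrt \<mu>"
  define y0 where "y0 = B x0 /\<^sub>R m0"
  have \<rho>: "\<rho> > 0" and m0: "m0 > 0" and m0\<mu>: "m0 * m0 = \<mu>"
    using c0 \<mu> by (simp_all add: \<rho>_def m0_def)
  have cc: "c \<bullet> c = \<rho> * \<rho>" by (simp add: \<rho>_def dot_square_norm power2_eq_square)
  have x0V: "x0 \<in> V" and y0V: "y0 \<in> V"
    unfolding x0_def y0_def using cV inv sub by (auto intro!: subspace_mul)
  have Bx0: "B x0 = m0 *\<^sub>R y0" using m0 by (simp add: y0_def)
  have BBx0: "B (B x0) = (- \<mu>) *\<^sub>R x0"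
    by (simp add: x0_def linear_scale[OF lin] BBc)
  have By0: "B y0 = (- m0) *\<^sub>R x0"
    using m0 by (simp add: y0_def linear_scale[OF lin] BBx0 m0\<mu>[symmetric])
  have x0x0: "x0 \<bullet> x0 = 1" using \<rho> by (simp add: x0_def cc field_simps)
  have y0y0: "y0 \<bullet> y0 = 1"
    using skew[of x0 y0] m0 By0 Bx0 x0x0 by simp
  have x0y0: "x0 \<bullet> y0 = 0" by (simp add: y0_def skew_self)
  have vx0: "v \<bullet> x0 = \<rho>" using \<rho> cv cc by (simp add: x0_def inner_commute)
  have vy0: "v \<bullet> y0 = 0"
    using Bcv by (simp add: y0_def x0_def linear_scale[OF lin] inner_commute)
  have old: "x i \<bullet> x0 = 0 \<and> y i \<bullet> x0 = 0 \<and> x i \<bullet> y0 = 0 \<and> y i \<bullet> y0 = 0" if "i \<in> {1..p}" for i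
    using x0V y0V that by (simp add: V_def inner_commute)
  \<comment> \<open>If two planes had the same speed, this combination of \<open>x0\<close> and
    \<open>x i\<close> would stay in the common eigenspace, with coefficients chosen to cancel the
    components of \<open>v\<close>; \<open>cyclic\<close> forces it to vanish.\<close>
  have new: "m0 \<noteq> m i" if i: "i \<in> {1..p}" for i
  proof
    assume eq: "m0 = m i"
    define w where "w = r i *\<^sub>R x0 - \<rho> *\<^sub>R x i"
    have Pi: "B (x i) = m i *\<^sub>R y i" "B (y i) = (- m i) *\<^sub>R x i" "v \<bullet> x i = r i" "v \<bullet> y i = 0"
        "r i > 0" "x i \<bullet> x i = 1"
      using P i by (auto simp: rotation_planes_def)
    have Bw: "B w = m0 *\<^sub>R (r i *\<^sub>R y0 - \<rho> *\<^sub>R y i)"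
      by (simp add: w_def linear_diff[OF lin] linear_scale[OF lin] Bx0 Pi eq algebra_simps)
    have "B (B w) = (- (m0 * m0)) *\<^sub>R w"
      by (simp add: Bw linear_diff[OF lin] linear_scale[OF lin] By0 Pi)
        (simp add: w_def eq algebra_simps)
    moreover have "w \<bullet> v = 0"
      using vx0 Pi(3) by (simp add: w_def inner_diff_right inner_commute[of _ v])
    moreover have "w \<bullet> B v = 0"
      using skew[of w v] vy0 Pi(4) by (simp add: Bw inner_diff_right inner_commute[of _ v])
    ultimately have "w = 0" by (rule cyclic)
    moreover have "w \<bullet> x0 = r i"
      using old[OF i] x0x0 by (simp add: w_def inner_diff_left)
    ultimately show False using Pi(5) by simp
  qed
  have "rotation_planes (Suc p) (x(Suc p := x0)) (y(Suc p := y0)) (m(Suc p := m0)) (r(Suc p := \<rho>))"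
  proof -
    have old_index: "i \<in> {1..p}" if "i \<in> {1..Suc p}" "i \<noteq> Suc p" for i
      using that by auto
    have Pij: "x i \<bullet> x j = (if i = j then 1 else 0)" "y i \<bullet> y j = (if i = j then 1 else 0)"
      "x i \<bullet> y j = 0" if "i \<in> {1..p}" "j \<in> {1..p}" for i j
      using P that unfolding rotation_planes_def by blast+
    have Pi: "m i > 0 \<and> r i > 0 \<and> B (x i) = m i *\<^sub>R y i \<and> B (y i) = (- m i) *\<^sub>R x i \<and>
      v \<bullet> x i = r i \<and> v \<bullet> y i = 0" if "i \<in> {1..p}" for i
      using P that unfolding rotation_planes_def by blast
    have inj: "inj_on m {1..p}" using P unfolding rotation_planes_def by blast
    have new': "x0 \<bullet> x i = 0" "y0 \<bullet> y i = 0" "x0 \<bullet> y i = 0" "x i \<bullet> x0 = 0" "y i \<bullet> y0 = 0" "x i \<bullet> y0 = 0"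
      if "i \<in> {1..p}" for i
      using old[OF that] by (simp_all add: inner_commute)
    let ?x = "x(Suc p := x0)" and ?y = "y(Suc p := y0)" and ?m = "m(Suc p := m0)" and ?r = "r(Suc p := \<rho>)"
    have A: "?x i \<bullet> ?x j = (if i = j then 1 else 0) \<and> ?y i \<bullet> ?y j = (if i = j then 1 else 0) \<and> ?x i \<bullet> ?y j = 0"
      and C: "?m i = ?m j \<Longrightarrow> i = j"
      if i: "i \<in> {1..Suc p}" and j: "j \<in> {1..Suc p}" for i j
    proof -
      consider "i = Suc p" "j = Suc p" | "i = Suc p" "j \<noteq> Suc p" | "i \<noteq> Suc p" "j = Suc p"
        | "i \<noteq> Suc p" "j \<noteq> Suc p" by blast
      then have "(?x i \<bullet> ?x j = (if i = j then 1 else 0) \<and> ?y i \<bullet> ?y j = (if i = j then 1 else 0) \<and>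
        ?x i \<bullet> ?y j = 0) \<and> (?m i = ?m j \<longrightarrow> i = j)"
      proof cases
        case 1
        then show ?thesis using x0x0 y0y0 x0y0 by simp
      next
        case 2
        then show ?thesis using new'[OF old_index[OF j 2(2)]] new[OF old_index[OF j 2(2)]] by simp
      next
        case 3
        then show ?thesis using new'[OF old_index[OF i 3(1)]] new[OF old_index[OF i 3(1)]] by simp
      next
        case 4
        then show ?thesis
          using Pij[OF old_index[OF i 4(1)] old_index[OF j 4(2)]]
            inj_onD[OF inj _ old_index[OF i 4(1)] old_index[OF j 4(2)]] by simp
      qed
      then show "?x i \<bullet> ?x j = (if i = j then 1 else 0) \<and> ?y i \<bullet> ?y j = (if i = j then 1 else 0) \<and> ?x i \<bullet> ?y j = 0"
        and "?m i = ?m j \<Longrightarrow> i = j" by blast+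
    qed
    have D: "?m i > 0 \<and> ?r i > 0 \<and> B (?x i) = ?m i *\<^sub>R ?y i \<and> B (?y i) = (- ?m i) *\<^sub>R ?x i \<and>
      v \<bullet> ?x i = ?r i \<and> v \<bullet> ?y i = 0" if i: "i \<in> {1..Suc p}" for i
    proof (cases "i = Suc p")
      case True
      then show ?thesis using m0 \<rho> Bx0 By0 vx0 vy0 by simp
    next
      case False
      then show ?thesis using Pi[OF old_index[OF i False]] by simp
    qed
    have "inj_on ?m {1..Suc p}" by (rule inj_onI) (rule C)
    then show ?thesis
      unfolding rotation_planes_def using A D by blast
  qed
  then show ?thesis by blast
qed

lemma rotation_planes_exist:
  "2 * p \<le> DIM('a) \<Longrightarrow> \<exists>x y m r. rotation_planes p x y m r"
proof (induction p)
  case 0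
  then show ?case by (simp add: rotation_planes_def)
next
  case (Suc p)
  then show ?case using rotation_planes_extend[of p] by auto
qed

text \<open>\<open>DIM('a) div 2\<close> planes fill the space up to at most one dimension. A unit
  vector \<open>z\<close> left over in odd dimension lies in the kernel: \<open>B z\<close> is
  orthogonal to all planes by invariance and to \<open>z\<close> by skew-symmetry.\<close>

lemma normal_form:
  obtains b :: "nat \<Rightarrow> 'a" and m r :: "nat \<Rightarrow> real"
  where "\<And>i j. i \<in> {1..DIM('a)} \<Longrightarrow> j \<in> {1..DIM('a)} \<Longrightarrow> b i \<bullet> b j = (if i = j then 1 else 0)"
    and "\<And>i. i \<in> {1..DIM('a) div 2} \<Longrightarrow> m i > 0 \<and> r i > 0 \<and>
      B (b (2 * i - 1)) = m i *\<^sub>R b (2 * i) \<and> B (b (2 * i)) = (- m i) *\<^sub>R b (2 * i - 1) \<and>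
      v \<bullet> b (2 * i - 1) = r i \<and> v \<bullet> b (2 * i) = 0"
    and "inj_on m {1..DIM('a) div 2}"
    and "odd DIM('a) \<Longrightarrow> B (b DIM('a)) = 0"
proof -
  define k where "k = DIM('a) div 2"
  obtain x y m r where P: "rotation_planes k x y m r"
    using rotation_planes_exist[of k] by (auto simp: k_def)
  \<comment> \<open>In even dimension the planes already fill the space, and \<open>z\<close> is set
    to the dummy value 0.\<close>
  obtain z where z: "odd DIM('a) \<Longrightarrow> z \<bullet> z = 1"
    "odd DIM('a) \<Longrightarrow> i \<in> {1..k} \<Longrightarrow> z \<bullet> x i = 0 \<and> z \<bullet> y i = 0" for i
  proof (cases "odd DIM('a)")
    case False
    then show ?thesis using that[of 0] by auto
  next
    case True
    let ?S = "x ` {1..k} \<union> y ` {1..k}"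
    have "card ?S \<le> card (x ` {1..k}) + card (y ` {1..k})"
      using card_Un_le by blast
    also have "\<dots> \<le> k + k"
      using card_image_le[of "{1..k}" x] card_image_le[of "{1..k}" y] by simp
    also have "\<dots> < DIM('a)" using True by (auto simp: k_def elim: oddE)
    finally have "dim ?S < DIM('a)"
      using dim_le_card'[of ?S] by simp
    then obtain u where u: "u \<noteq> 0" "\<And>z. z \<in> span ?S \<Longrightarrow> orthogonal u z"
      using orthogonal_to_subspace_exists[of ?S] by auto
    have "u \<bullet> z = 0" if "z \<in> ?S" for z
      using u(2)[of z] that by (simp add: span_base orthogonal_def)
    then show ?thesis
      using u(1) by (intro that[of "sgn u"]) (auto simp: sgn_div_norm dot_square_norm power2_eq_square)
  qed
  \<comment> \<open>Lists x 1, y 1, x 2, y 2 and so on. In odd dimension the last index would ask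
    for the plane number \<open>k + 1\<close>, so it gets \<open>z\<close>.\<close>
  define b where "b j = (if odd j then (if j = DIM('a) then z else x ((j + 1) div 2)) else y (j div 2))" for j
  have onP: "x i \<bullet> x j = (if i = j then 1 else 0)" "y i \<bullet> y j = (if i = j then 1 else 0)"
      "x i \<bullet> y j = 0" "y i \<bullet> x j = 0" if "i \<in> {1..k}" "j \<in> {1..k}" for i j
    using P that by (auto simp: rotation_planes_def inner_commute)
  have on: "b i \<bullet> b j = (if i = j then 1 else 0)"
    if i: "i \<in> {1..DIM('a)}" and j: "j \<in> {1..DIM('a)}" for i j
  proof -
    have o: "(i + 1) div 2 \<in> {1..k}" if "odd i" "i \<noteq> DIM('a)" "i \<in> {1..DIM('a)}" for i
      using that by (auto simp: k_def elim!: oddE)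
    have e: "i div 2 \<in> {1..k}" if "even i" "i \<in> {1..DIM('a)}" for i
      using that by (auto simp: k_def elim!: evenE)
    have bo: "b i = (if i = DIM('a) then z else x ((i + 1) div 2))" if "odd i" for i
      using that by (simp add: b_def)
    have be: "b i = y (i div 2)" if "even i" for i
      using that by (simp add: b_def)
    show ?thesis
    proof (cases "odd i"; cases "odd j")
      assume p: "odd i" "odd j"
      then have eq: "(i + 1) div 2 = (j + 1) div 2 \<longleftrightarrow> i = j"
        by (auto elim!: oddE)
      consider "i = DIM('a)" "j = DIM('a)" | "i = DIM('a)" "j \<noteq> DIM('a)"
        | "i \<noteq> DIM('a)" "j = DIM('a)" | "i \<noteq> DIM('a)" "j \<noteq> DIM('a)" by blast
      then show ?thesis
      proof cases
        case 1
        then show ?thesis using p(1) z(1) by (simp add: bo)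
      next
        case 2
        have "z \<bullet> x ((j + 1) div 2) = 0" using z(2) o[of j] p j 2 by metis
        moreover have "b i = z" "b j = x ((j + 1) div 2)" using 2 p by (simp_all add: bo)
        ultimately show ?thesis using 2 by simp
      next
        case 3
        have "z \<bullet> x ((i + 1) div 2) = 0" using z(2) o[of i] p i 3 by metis
        moreover have "b j = z" "b i = x ((i + 1) div 2)" using 3 p by (simp_all add: bo)
        ultimately show ?thesis using 3 by (simp add: inner_commute)
      next
        case 4
        then have "b i = x ((i + 1) div 2)" "b j = x ((j + 1) div 2)" using p by (simp_all add: bo)
        then show ?thesis
          using onP(1)[OF o[OF p(1) 4(1) i] o[OF p(2) 4(2) j]] eq by metis
      qed
    next
      assume p: "odd i" "\<not> odd j"
      have "b i \<bullet> b j = 0"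
      proof (cases "i = DIM('a)")
        case True
        then show ?thesis using z(2)[OF _ e[of j]] p j by (simp add: bo be)
      next
        case False
        then show ?thesis using onP(3)[OF o[OF p(1) False i] e[of j]] p j by (simp add: bo be)
      qed
      then show ?thesis using p by metis
    next
      assume p: "\<not> odd i" "odd j"
      have "b j \<bullet> b i = 0"
      proof (cases "j = DIM('a)")
        case True
        then show ?thesis using z(2)[OF _ e[of i]] p i by (simp add: bo be)
      next
        case False
        then show ?thesis using onP(3)[OF o[OF p(2) False j] e[of i]] p i by (simp add: bo be)
      qed
      then show ?thesis using p by (metis inner_commute)
    next
      assume p: "\<not> odd i" "\<not> odd j"
      then have "i div 2 = j div 2 \<longleftrightarrow> i = j"
        by (auto elim!: evenE)
      then show ?thesis
        using onP(2)[of "i div 2" "j div 2"] e[of i] e[of j] p i j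
        by (simp add: be)
    qed
  qed
  have bx: "b (2 * i - 1) = x i" and byy: "b (2 * i) = y i" if "i \<in> {1..k}" for i
  proof -
    have "2 * i - 1 \<noteq> DIM('a)" "odd (2 * i - 1)" "(2 * i - 1 + 1) div 2 = i"
      using that by (auto simp: k_def)
    then show "b (2 * i - 1) = x i" by (simp add: b_def)
    show "b (2 * i) = y i" by (simp add: b_def)
  qed
  show ?thesis
  proof (rule that[of b m r, folded k_def])
    show "m i > 0 \<and> r i > 0 \<and>
      B (b (2 * i - 1)) = m i *\<^sub>R b (2 * i) \<and> B (b (2 * i)) = (- m i) *\<^sub>R b (2 * i - 1) \<and>
      v \<bullet> b (2 * i - 1) = r i \<and> v \<bullet> b (2 * i) = 0" if "i \<in> {1..k}" for i
      using P that unfolding bx[OF that] byy[OF that] by (auto simp: rotation_planes_def)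
    show "inj_on m {1..k}" using P by (simp add: rotation_planes_def)
    show "B (b DIM('a)) = 0" if odd: "odd DIM('a)"
    proof (rule orthonormal_eq_0[of b, OF on])
      have bz: "b DIM('a) = z" using odd by (simp add: b_def)
      fix i assume i: "i \<in> {1..DIM('a)}"
      have perp: "B z \<bullet> x j = 0 \<and> B z \<bullet> y j = 0" if "j \<in> {1..k}" for j
        by (rule rotation_planes_complement_invariant[OF P z(2)[OF odd] that])
      show "B (b DIM('a)) \<bullet> b i = 0"
      proof (cases "i = DIM('a)")
        case True
        then show ?thesis using skew_self[of z] by (simp add: bz inner_commute)
      next
        case False
        have "(odd i \<longrightarrow> (i + 1) div 2 \<in> {1..k}) \<and> (even i \<longrightarrow> i div 2 \<in> {1..k})"
          using i False by (auto simp: k_def elim!: oddE evenE)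
        then show ?thesis using perp False by (simp add: bz) (simp add: b_def)
      qed
    qed
  qed (fact on)
qed

end

section \<open>Curves with constant curvature ratios\<close>

text \<open>The zero values of \<kappa> at the indices 0 and \<open>DIM('a)\<close> give all Frenet
  equations the same shape: they remove the terms with \<open>e 0\<close> and
  \<open>e (Suc DIM('a))\<close>, which lie outside the frame. Continuity is asked of
  \<open>\<kappa> 1\<close> because it is the function to be integrated.\<close>

locale frenet_system =
  fixes I :: "real set" and e :: "nat \<Rightarrow> real \<Rightarrow> 'a::euclidean_space" and \<kappa> :: "nat \<Rightarrow> real \<Rightarrow> real"
  assumes open_I: "open I" and interval_I: "is_interval I" and nonempty_I: "I \<noteq> {}"
    and dim2: "DIM('a) \<ge> 2"
    and orthonormal: "\<And>s i j. s \<in> I \<Longrightarrow> i \<in> {1..DIM('a)} \<Longrightarrow> j \<in> {1..DIM('a)} \<Longrightarrow>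
      e i s \<bullet> e j s = (if i = j then 1 else 0)"
    and kappa_0: "\<And>s. \<kappa> 0 s = 0" and kappa_dim: "\<And>s. \<kappa> DIM('a) s = 0"
    and kappa_nonzero: "\<And>i s. i \<in> {1..<DIM('a)} \<Longrightarrow> s \<in> I \<Longrightarrow> \<kappa> i s \<noteq> 0"
    and frenet: "\<And>i s. i \<in> {1..DIM('a)} \<Longrightarrow> s \<in> I \<Longrightarrow>
      (e i has_vector_derivative \<kappa> i s *\<^sub>R e (Suc i) s - \<kappa> (i - 1) s *\<^sub>R e (i - 1) s) (at s)"
    and kappa_1_continuous: "continuous_on I (\<kappa> 1)"
begin

lemma connected_I: "connected I"
  using interval_I by (simp add: is_interval_connected_1)

lemma constant_of_zero_derivative:
  fixes f :: "real \<Rightarrow> 'b::real_normed_vector"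
  assumes "\<And>s. s \<in> I \<Longrightarrow> (f has_vector_derivative 0) (at s)" and "s \<in> I" "t \<in> I"
  shows "f s = f t"
  using has_derivative_zero_unique_connected[OF open_I connected_I _ assms(2,3), of f] assms(1)
  by (simp add: has_vector_derivative_def)

lemma e_continuous: "i \<in> {1..DIM('a)} \<Longrightarrow> continuous_on I (e i)"
  using frenet by (intro continuous_at_imp_continuous_on ballI)
    (blast intro: has_vector_derivative_continuous)

text \<open>The interval may be unbounded, so it is described by end points in the extended reals,
  where continuity on the open interval suffices for an antiderivative.\<close>

lemma antiderivative_kappa_1:
  obtains g where "\<And>s. s \<in> I \<Longrightarrow> (g has_vector_derivative \<kappa> 1 s) (at s)"
proof -
  define a b where "a = Inf (ereal ` I)" and "b = Sup (ereal ` I)"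
  have I_eq: "s \<in> I \<longleftrightarrow> a < ereal s \<and> ereal s < b" for s
  proof
    assume "s \<in> I"
    then obtain d where d: "d > 0" "ball s d \<subseteq> I"
      using open_I open_contains_ball by blast
    then have "s - d / 2 \<in> I" "s + d / 2 \<in> I"
      by (auto simp: subset_eq dist_real_def)
    then have "a \<le> ereal (s - d / 2)" "ereal (s + d / 2) \<le> b"
      unfolding a_def b_def by (auto intro: Inf_lower Sup_upper)
    then show "a < ereal s \<and> ereal s < b"
      using d(1) by (meson ereal_less_eq(3) leD leI le_less_trans less_le_trans less_ereal.simps(1)
          diff_less_eq half_gt_zero less_add_same_cancel1)
  next
    assume "a < ereal s \<and> ereal s < b"
    then obtain x y where "x \<in> I" "y \<in> I" "x < s" "s < y"
      by (auto simp: a_def b_def Inf_less_iff less_Sup_iff)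
    then show "s \<in> I"
      using interval_I by (meson less_imp_le mem_is_interval_1_I)
  qed
  have "a < b"
    using nonempty_I I_eq by (meson ex_in_conv less_trans)
  moreover have "isCont (\<kappa> 1) s" if "a < ereal s" "ereal s < b" for s
    using that I_eq kappa_1_continuous open_I by (simp add: continuous_on_eq_continuous_at)
  ultimately obtain g where "\<forall>s. a < ereal s \<longrightarrow> ereal s < b \<longrightarrow> (g has_vector_derivative \<kappa> 1 s) (at s)"
    using einterval_antiderivative[of a b "\<kappa> 1"] by auto
  then show ?thesis using that I_eq by blast
qed

end

section \<open>The infinitesimal rotation of a curve with constant curvature ratios\<close>

locale constant_ratios = frenet_system I e \<kappa>
  for I and e :: "nat \<Rightarrow> real \<Rightarrow> 'a::euclidean_space" and \<kappa> +
  fixes c :: "nat \<Rightarrow> real"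
  assumes ratio: "\<And>i s. i \<le> DIM('a) \<Longrightarrow> s \<in> I \<Longrightarrow> \<kappa> i s = c i * \<kappa> 1 s"
    and c_nonzero: "\<And>i. i \<in> {1..<DIM('a)} \<Longrightarrow> c i \<noteq> 0"
    and c_0: "c 0 = 0" and c_dim: "c DIM('a) = 0"
begin

text \<open>A weighted sum of infinitesimal rotations in the planes of consecutive frame vectors.
  Written so, it acts on fixed vectors \<open>x\<close>, its skew-symmetry holds term by term, and
  it can be differentiated in \<open>s\<close> by the product rule.\<close>

definition rot :: "real \<Rightarrow> 'a \<Rightarrow> 'a"
  where "rot s x = (\<Sum>i\<in>{1..<DIM('a)}.
    c i *\<^sub>R ((x \<bullet> e i s) *\<^sub>R e (Suc i) s - (x \<bullet> e (Suc i) s) *\<^sub>R e i s))"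

lemma linear_rot: "linear (rot s)"
  by (rule linearI)
    (simp_all add: rot_def inner_add_left algebra_simps scaleR_sum_right flip: sum.distrib sum_subtractf)

lemma rot_skew: "rot s x \<bullet> y = - (x \<bullet> rot s y)"
  unfolding rot_def inner_sum_left inner_sum_right sum_negf[symmetric]
  by (rule sum.cong) (auto simp: inner_diff_left inner_diff_right inner_commute algebra_simps)

lemma rot_frame:
  assumes s: "s \<in> I" and j: "j \<in> {1..DIM('a)}"
  shows "rot s (e j s) = c j *\<^sub>R e (Suc j) s - c (j - 1) *\<^sub>R e (j - 1) s"
proof -
  have "rot s (e j s) = (\<Sum>i\<in>{1..<DIM('a)}. (if i = j then c i *\<^sub>R e (Suc i) s else 0) -
      (if i = j - 1 then c i *\<^sub>R e i s else 0))"
    unfolding rot_def using j by (intro sum.cong) (auto simp: orthonormal[OF s])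
  also have "\<dots> = (if j \<in> {1..<DIM('a)} then c j *\<^sub>R e (Suc j) s else 0) -
      (if j - 1 \<in> {1..<DIM('a)} then c (j - 1) *\<^sub>R e (j - 1) s else 0)"
    by (simp add: sum_subtractf del: atLeastLessThan_iff)
  also have "\<dots> = c j *\<^sub>R e (Suc j) s - c (j - 1) *\<^sub>R e (j - 1) s"
  proof -
    have "(if j \<in> {1..<DIM('a)} then c j *\<^sub>R e (Suc j) s else 0) = c j *\<^sub>R e (Suc j) s"
      using j c_dim by (cases "j = DIM('a)") simp_all
    moreover have "(if j - 1 \<in> {1..<DIM('a)} then c (j - 1) *\<^sub>R e (j - 1) s else 0) =
        c (j - 1) *\<^sub>R e (j - 1) s"
    proof (cases "j = 1")
      case True
      then show ?thesis by (simp add: c_0)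
    next
      case False
      then have "j - 1 \<in> {1..<DIM('a)}" using j by auto
      then show ?thesis by (rule if_P)
    qed
    ultimately show ?thesis by (simp only:)
  qed
  finally show ?thesis .
qed

lemma frame_derivative:
  assumes "s \<in> I" and "j \<in> {1..DIM('a)}"
  shows "(e j has_vector_derivative \<kappa> 1 s *\<^sub>R rot s (e j s)) (at s)"
proof -
  have "\<kappa> j s = c j * \<kappa> 1 s" "\<kappa> (j - 1) s = c (j - 1) * \<kappa> 1 s"
    using assms by (auto intro!: ratio[unfolded One_nat_def])
  then have "\<kappa> j s *\<^sub>R e (Suc j) s - \<kappa> (j - 1) s *\<^sub>R e (j - 1) s = \<kappa> 1 s *\<^sub>R rot s (e j s)"
    by (simp only: rot_frame[OF assms] scaleR_diff_right scaleR_scaleR mult.commute)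
  then show ?thesis
    using frenet[OF assms(2,1)] by simp
qed

text \<open>When the derivative hits the vector factors, \<open>frame_derivative\<close> gives
  \<kappa> 1 times \<open>rot s (rot s x)\<close>; when it hits the scalar factors, skew-symmetry
  moves \<open>rot s\<close> onto \<open>x\<close> with a minus sign and gives the same vector
  negated.\<close>

lemma rot_derivative:
  assumes s: "s \<in> I"
  shows "((\<lambda>s. rot s x) has_vector_derivative 0) (at s)"
proof -
  let ?B = "rot s"
  have "((\<lambda>s. rot s x) has_vector_derivative (\<Sum>i\<in>{1..<DIM('a)}. c i *\<^sub>R
     (((x \<bullet> e i s) *\<^sub>R (\<kappa> 1 s *\<^sub>R ?B (e (Suc i) s)) + (x \<bullet> (\<kappa> 1 s *\<^sub>R ?B (e i s))) *\<^sub>R e (Suc i) s) -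
      ((x \<bullet> e (Suc i) s) *\<^sub>R (\<kappa> 1 s *\<^sub>R ?B (e i s)) + (x \<bullet> (\<kappa> 1 s *\<^sub>R ?B (e (Suc i) s))) *\<^sub>R e i s)))) (at s)"
    (is "(_ has_vector_derivative ?D) _")
    unfolding rot_def[of _ x]
  proof (intro has_vector_derivative_sum has_vector_derivative_diff
      bounded_linear.has_vector_derivative[OF bounded_linear_scaleR_right])
    fix i assume "i \<in> {1..<DIM('a)}"
    then have i: "i \<in> {1..DIM('a)}" "Suc i \<in> {1..DIM('a)}" by auto
    have product: "((\<lambda>s. (x \<bullet> f s) *\<^sub>R h s) has_vector_derivative (x \<bullet> f s) *\<^sub>R h' + (x \<bullet> f') *\<^sub>R h s) (at s)"
      if "(f has_vector_derivative f') (at s)" "(h has_vector_derivative h') (at s)"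
      for f h :: "real \<Rightarrow> 'a" and f' h'
      using bounded_linear.has_vector_derivative[OF bounded_linear_inner_right that(1), of x] that(2)
      by (intro has_vector_derivative_scaleR)
        (simp_all add: has_real_derivative_iff_has_vector_derivative)
    show "((\<lambda>s. (x \<bullet> e i s) *\<^sub>R e (Suc i) s) has_vector_derivative
        (x \<bullet> e i s) *\<^sub>R (\<kappa> 1 s *\<^sub>R ?B (e (Suc i) s)) + (x \<bullet> (\<kappa> 1 s *\<^sub>R ?B (e i s))) *\<^sub>R e (Suc i) s) (at s)"
      "((\<lambda>s. (x \<bullet> e (Suc i) s) *\<^sub>R e i s) has_vector_derivative
        (x \<bullet> e (Suc i) s) *\<^sub>R (\<kappa> 1 s *\<^sub>R ?B (e i s)) + (x \<bullet> (\<kappa> 1 s *\<^sub>R ?B (e (Suc i) s))) *\<^sub>R e i s) (at s)"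
      by (intro product frame_derivative[OF s] i)+
  qed
  also have "?D = \<kappa> 1 s *\<^sub>R (?B (?B x) - ?B (?B x))"
  proof -
    have "?D = \<kappa> 1 s *\<^sub>R ((\<Sum>i\<in>{1..<DIM('a)}. c i *\<^sub>R ((x \<bullet> e i s) *\<^sub>R ?B (e (Suc i) s) -
        (x \<bullet> e (Suc i) s) *\<^sub>R ?B (e i s))) -
      (\<Sum>i\<in>{1..<DIM('a)}. c i *\<^sub>R ((?B x \<bullet> e i s) *\<^sub>R e (Suc i) s - (?B x \<bullet> e (Suc i) s) *\<^sub>R e i s)))"
      by (simp add: scaleR_sum_right rot_skew[of s x] algebra_simps flip: sum_subtractf)
    also have "(\<Sum>i\<in>{1..<DIM('a)}. c i *\<^sub>R ((x \<bullet> e i s) *\<^sub>R ?B (e (Suc i) s) -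
        (x \<bullet> e (Suc i) s) *\<^sub>R ?B (e i s))) = ?B (?B x)"
      by (simp add: rot_def[of s x] linear_sum[OF linear_rot] linear_scale[OF linear_rot]
          linear_diff[OF linear_rot])
    also have "(\<Sum>i\<in>{1..<DIM('a)}. c i *\<^sub>R ((?B x \<bullet> e i s) *\<^sub>R e (Suc i) s -
        (?B x \<bullet> e (Suc i) s) *\<^sub>R e i s)) = ?B (?B x)"
      by (rule rot_def[of s "?B x", symmetric])
    finally show ?thesis .
  qed
  finally show ?thesis by simp
qed

lemma rot_constant: "s \<in> I \<Longrightarrow> t \<in> I \<Longrightarrow> rot s = rot t"
  using constant_of_zero_derivative[OF rot_derivative] by blast

text \<open>The three-term recursion of \<open>rot_frame\<close> propagates orthogonality to the
  frame: for \<open>u = w\<close> and \<open>u = rot s w\<close> it expresses c j times the product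
  of \<open>u\<close> and \<open>e (Suc j) s\<close> through earlier products. Both vectors are
  carried along together because \<open>rot s\<close> maps the second back to a multiple of the
  first.\<close>

lemma skew_cyclic_rot:
  assumes s: "s \<in> I"
  shows "skew_cyclic (rot s) (e 1 s)"
proof
  show "rot s (x + y) = rot s x + rot s y" "rot s (a *\<^sub>R x) = a *\<^sub>R rot s x" for x y a
    by (simp_all add: linear_add[OF linear_rot] linear_scale[OF linear_rot])
  show "rot s x \<bullet> y = - (x \<bullet> rot s y)" for x y by (rule rot_skew)
  fix w l
  assume l: "rot s (rot s w) = l *\<^sub>R w" and w: "w \<bullet> e 1 s = 0" "w \<bullet> rot s (e 1 s) = 0"
  have "i \<in> {1..DIM('a)} \<Longrightarrow> w \<bullet> e i s = 0 \<and> rot s w \<bullet> e i s = 0" for i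
  proof (induction i rule: less_induct)
    case (less i)
    show ?case
    proof (cases "i = 1")
      case True
      then show ?thesis using w by (simp add: rot_skew)
    next
      case False
      define j where "j = i - 1"
      have j: "i = Suc j" "j \<in> {1..<DIM('a)}" using less.prems False by (auto simp: j_def)
      \<comment> \<open>For \<open>j = 1\<close> the vector \<open>e 0 s\<close> is outside the
        frame, but its coefficient \<open>c 0\<close> is zero.\<close>
      have zero: "c (j - 1) * (u \<bullet> e (j - 1) s) = 0" if "u = w \<or> u = rot s w" for u
      proof (cases "j = 1")
        case True
        then show ?thesis using c_0 by simp
      next
        case False
        then have "j - 1 < i" "j - 1 \<in> {1..DIM('a)}" using j by auto
        then show ?thesis using that less.IH[of "j - 1"] by auto
      qed
      have "c j * (u \<bullet> e i s) = 0" if u: "u = w \<or> u = rot s w" for u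
      proof -
        have "rot s u \<bullet> e j s = 0"
          using u less.IH[of j] j by (auto simp: l)
        then have "u \<bullet> rot s (e j s) = 0" by (simp add: rot_skew)
        then show ?thesis
          using zero[OF u] j by (simp add: rot_frame[OF s] inner_diff_right)
      qed
      then show ?thesis using c_nonzero[OF j(2)] by auto
    qed
  qed
  then show "w = 0"
    by (intro orthonormal_eq_0[of "\<lambda>i. e i s"]) (use orthonormal[OF s] in auto)
qed

text \<open>
  The rotation trick: a solution of \<open>f' = - \<mu> h g'\<close>, \<open>h' = \<mu> f g'\<close> turned back by the angle
  \<open>\<mu> g\<close> is constant.
\<close>

lemma rotating_pair:
  fixes f h g :: "real \<Rightarrow> real"
  assumes g: "\<And>s. s \<in> I \<Longrightarrow> (g has_real_derivative \<kappa> 1 s) (at s)"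
    and f: "\<And>s. s \<in> I \<Longrightarrow> (f has_real_derivative - (\<kappa> 1 s * \<mu> * h s)) (at s)"
    and h: "\<And>s. s \<in> I \<Longrightarrow> (h has_real_derivative \<kappa> 1 s * \<mu> * f s) (at s)"
    and s0: "s0 \<in> I" "g s0 = 0" "f s0 = \<rho>" "h s0 = 0" and s: "s \<in> I"
  shows "f s = \<rho> * cos (\<mu> * g s) \<and> h s = \<rho> * sin (\<mu> * g s)"
proof -
  define p where "p s = f s * cos (\<mu> * g s) + h s * sin (\<mu> * g s)" for s
  define q where "q s = h s * cos (\<mu> * g s) - f s * sin (\<mu> * g s)" for s
  have "(p has_vector_derivative 0) (at s)" if "s \<in> I" for s
    unfolding p_def has_real_derivative_iff_has_vector_derivative[symmetric]
    by (rule derivative_eq_intros f[OF that] g[OF that] h[OF that] refl)+ (simp add: algebra_simps)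
  from constant_of_zero_derivative[OF this s s0(1)] have p: "p s = \<rho>"
    using s0 by (simp add: p_def)
  have "(q has_vector_derivative 0) (at s)" if "s \<in> I" for s
    unfolding q_def has_real_derivative_iff_has_vector_derivative[symmetric]
    by (rule derivative_eq_intros f[OF that] g[OF that] h[OF that] refl)+ (simp add: algebra_simps)
  from constant_of_zero_derivative[OF this s s0(1)] have q: "q s = 0"
    using s0 by (simp add: q_def)
  define C S where "C = cos (\<mu> * g s)" and "S = sin (\<mu> * g s)"
  have one: "C * C + S * S = 1"
    by (simp add: C_def S_def)
  have "f s * (C * C + S * S) = p s * C - q s * S"
    "h s * (C * C + S * S) = p s * S + q s * C"
    by (simp_all add: p_def q_def C_def[symmetric] S_def[symmetric] algebra_simps)
  then show ?thesis by (simp add: one p q C_def S_def)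
qed

text \<open>With respect to the normal form of the one map \<open>rot s0\<close>, the equation for
  the tangent decouples into the planar systems solved by \<open>rotating_pair\<close>, plus a
  constant coordinate in odd dimension.\<close>

lemma tangent_in_normal_form:
  obtains b :: "nat \<Rightarrow> 'a" and m r :: "nat \<Rightarrow> real" and a :: real and g :: "real \<Rightarrow> real"
  where "\<And>i j. i \<in> {1..DIM('a)} \<Longrightarrow> j \<in> {1..DIM('a)} \<Longrightarrow> b i \<bullet> b j = (if i = j then 1 else 0)"
    and "\<And>i. i \<in> {1..DIM('a) div 2} \<Longrightarrow> m i > 0 \<and> r i > 0"
    and "inj_on m {1..DIM('a) div 2}"
    and "\<And>s. s \<in> I \<Longrightarrow> (g has_real_derivative \<kappa> 1 s) (at s)"
    and "\<And>s i. s \<in> I \<Longrightarrow> i \<in> {1..DIM('a) div 2} \<Longrightarrow>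
      e 1 s \<bullet> b (2 * i - 1) = r i * cos (m i * g s) \<and> e 1 s \<bullet> b (2 * i) = r i * sin (m i * g s)"
    and "\<And>s. s \<in> I \<Longrightarrow> odd DIM('a) \<Longrightarrow> e 1 s \<bullet> b DIM('a) = a"
proof -
  obtain s0 where s0: "s0 \<in> I" using nonempty_I by blast
  obtain G where G: "\<And>s. s \<in> I \<Longrightarrow> (G has_vector_derivative \<kappa> 1 s) (at s)"
    using antiderivative_kappa_1 by blast
  \<comment> \<open>Normalized to vanish at \<open>s0\<close>, where the tangent has no component
    along \<open>b (2 * i)\<close>: this makes every phase zero.\<close>
  define g where "g s = G s - G s0" for s
  have g: "(g has_real_derivative \<kappa> 1 s) (at s)" if "s \<in> I" for s
    unfolding g_def using G[OF that]
    by (auto simp: has_real_derivative_iff_has_vector_derivative intro!: derivative_eq_intros)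
  interpret skew_cyclic "rot s0" "e 1 s0" by (rule skew_cyclic_rot[OF s0])
  obtain b and m r :: "nat \<Rightarrow> real" where
    on: "\<And>i j. i \<in> {1..DIM('a)} \<Longrightarrow> j \<in> {1..DIM('a)} \<Longrightarrow> b i \<bullet> b j = (if i = j then 1 else 0)"
    and pl: "\<And>i. i \<in> {1..DIM('a) div 2} \<Longrightarrow> m i > 0 \<and> r i > 0 \<and>
      rot s0 (b (2 * i - 1)) = m i *\<^sub>R b (2 * i) \<and> rot s0 (b (2 * i)) = (- m i) *\<^sub>R b (2 * i - 1) \<and>
      e 1 s0 \<bullet> b (2 * i - 1) = r i \<and> e 1 s0 \<bullet> b (2 * i) = 0"
    and inj: "inj_on m {1..DIM('a) div 2}"
    and ker: "odd DIM('a) \<Longrightarrow> rot s0 (b DIM('a)) = 0"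
    using normal_form by blast
  \<comment> \<open>Skew-symmetry moves \<open>rot s0\<close> onto the fixed vector
    \<open>w\<close>, so for a basis vector of the normal form the right-hand side is a multiple of
    a single other coordinate.\<close>
  have coord: "((\<lambda>s. e 1 s \<bullet> w) has_real_derivative - (\<kappa> 1 s * (e 1 s \<bullet> rot s0 w))) (at s)"
    if s: "s \<in> I" for s w
  proof -
    have "(e 1 has_vector_derivative \<kappa> 1 s *\<^sub>R rot s0 (e 1 s)) (at s)"
      using frame_derivative[OF s, of 1] rot_constant[OF s s0] by simp
    then have "((\<lambda>s. e 1 s \<bullet> w) has_vector_derivative (\<kappa> 1 s *\<^sub>R rot s0 (e 1 s)) \<bullet> w) (at s)"
      by (rule bounded_linear.has_vector_derivative[OF bounded_linear_inner_left])
    then show ?thesis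
      by (simp add: has_real_derivative_iff_has_vector_derivative rot_skew)
  qed
  show ?thesis
  proof (rule that[of b m r g "e 1 s0 \<bullet> b DIM('a)", OF on _ inj g])
    show "m i > 0 \<and> r i > 0" if "i \<in> {1..DIM('a) div 2}" for i
      using pl[OF that] by blast
  next
    fix s assume s: "s \<in> I"
    show "e 1 s \<bullet> b (2 * i - 1) = r i * cos (m i * g s) \<and> e 1 s \<bullet> b (2 * i) = r i * sin (m i * g s)"
      if i: "i \<in> {1..DIM('a) div 2}" for i
    proof (rule rotating_pair[OF g _ _ s0 _ _ _ s])
      show "((\<lambda>s. e 1 s \<bullet> b (2 * i - 1)) has_real_derivative
          - (\<kappa> 1 t * m i * (e 1 t \<bullet> b (2 * i)))) (at t)" if "t \<in> I" for t
        using coord[OF that, of "b (2 * i - 1)"] pl[OF i] by (simp add: mult.assoc)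
      show "((\<lambda>s. e 1 s \<bullet> b (2 * i)) has_real_derivative
          \<kappa> 1 t * m i * (e 1 t \<bullet> b (2 * i - 1))) (at t)" if "t \<in> I" for t
        using coord[OF that, of "b (2 * i)"] pl[OF i] by (simp add: mult.assoc)
      show "g s0 = 0" by (simp add: g_def)
      show "e 1 s0 \<bullet> b (2 * i - 1) = r i" "e 1 s0 \<bullet> b (2 * i) = 0"
        using pl[OF i] by blast+
    qed
    show "e 1 s \<bullet> b DIM('a) = e 1 s0 \<bullet> b DIM('a)" if "odd DIM('a)"
    proof (rule constant_of_zero_derivative[OF _ s s0, of "\<lambda>s. e 1 s \<bullet> b DIM('a)"])
      fix t assume "t \<in> I"
      from coord[OF this, of "b DIM('a)"] ker[OF that]
      show "((\<lambda>s. e 1 s \<bullet> b DIM('a)) has_vector_derivative 0) (at t)"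
        by (simp add: has_real_derivative_iff_has_vector_derivative)
    qed
  qed
qed

end

section \<open>Twisted geodesics on flat tori\<close>

context frenet_system
begin

text \<open>The Frenet equation for \<open>e j\<close> writes \<kappa> j times
  \<open>e (Suc j)\<close> as \<open>h s\<close> times a linear map \<open>R\<close>, commuting with
  \<open>B\<close>, applied to the tangent. As \<open>R (e 1 s)\<close> has constant length,
  \<kappa> j / h is constant up to sign, and dividing by it yields the next map \<open>Q\<close>.
  The index is shifted so that the induction starts at \<open>e 1\<close> with the identity.\<close>

lemma curvature_ratios_of_rotation:
  assumes lin: "linear B" and skew: "\<And>x y. B x \<bullet> y = - (x \<bullet> B y)"
    and der: "\<And>s. s \<in> I \<Longrightarrow> (e 1 has_vector_derivative h s *\<^sub>R B (e 1 s)) (at s)"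
    and h: "\<And>s. s \<in> I \<Longrightarrow> h s \<noteq> 0"
  shows "j < DIM('a) \<Longrightarrow> \<exists>Q c. linear Q \<and> (\<forall>x. Q (B x) = B (Q x)) \<and>
    (\<forall>s\<in>I. e (Suc j) s = Q (e 1 s)) \<and> (\<forall>s\<in>I. \<kappa> j s = c * h s)"
proof (induction j rule: less_induct)
  case (less j)
  show ?case
  proof (cases j)
    case 0
    then show ?thesis
      by (intro exI[of _ id] exI[of _ 0]) (simp add: kappa_0 linear_id[unfolded id_def])
  next
    case (Suc i)
    obtain Q c where Q: "linear Q" "\<And>x. Q (B x) = B (Q x)"
      and eQ: "\<And>s. s \<in> I \<Longrightarrow> e j s = Q (e 1 s)" and kc: "\<And>s. s \<in> I \<Longrightarrow> \<kappa> i s = c * h s"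
      using less.IH[of i] less.prems unfolding Suc by (metis Suc_lessD lessI)
    \<comment> \<open>Handles the term of the preceding frame vector; for \<open>i = 0\<close> that
      vector does not exist, and the zero map serves because \<kappa> 0 vanishes.\<close>
    obtain R' where R': "linear R'" "\<And>x. R' (B x) = B (R' x)"
      and eR': "\<And>s. s \<in> I \<Longrightarrow> \<kappa> i s *\<^sub>R e i s = h s *\<^sub>R R' (e 1 s)"
    proof (cases i)
      case 0
      then show ?thesis
        by (intro that[of "\<lambda>_. 0"]) (auto simp: kappa_0 linear_zero linear_0[OF lin])
    next
      case (Suc l)
      then obtain Q' where Q': "linear Q'" "\<And>x. Q' (B x) = B (Q' x)"
        and eQ': "\<And>s. s \<in> I \<Longrightarrow> e i s = Q' (e 1 s)"
        using less.IH[of l] less.prems \<open>j = Suc i\<close> by auto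
      show ?thesis
      proof (rule that[of "\<lambda>x. c *\<^sub>R Q' x"])
        show "linear (\<lambda>x. c *\<^sub>R Q' x)" by (rule linear_compose_scale_right[OF Q'(1)])
      qed (simp_all add: Q' eQ' kc linear_scale[OF lin] mult.commute)
    qed
    define R where "R x = Q (B x) + R' x" for x
    have linR: "linear R"
      unfolding R_def using linear_compose[OF lin Q(1)] R'(1)
      by (intro linear_compose_add) (simp_all add: o_def)
    have comm: "R (B x) = B (R x)" for x
      by (simp add: R_def Q R' linear_add[OF lin])
    have j: "j \<in> {1..DIM('a)}" "Suc j \<in> {1..DIM('a)}" "j \<in> {1..<DIM('a)}"
      using less.prems Suc by auto
    have derL: "((\<lambda>s. L (e 1 s)) has_vector_derivative h s *\<^sub>R L (B (e 1 s))) (at s)"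
      if "linear L" "s \<in> I" for L :: "'a \<Rightarrow> 'a" and s
      using bounded_linear.has_vector_derivative[OF _ der[OF that(2)], of L] that(1)
      by (simp add: linear_scale[OF that(1)] linear_conv_bounded_linear)
    have step: "\<kappa> j s *\<^sub>R e (Suc j) s = h s *\<^sub>R R (e 1 s)" if s: "s \<in> I" for s
    proof -
      have "(e j has_vector_derivative h s *\<^sub>R Q (B (e 1 s))) (at s)"
        by (rule has_vector_derivative_transform_within_open[OF derL[OF Q(1) s] open_I s])
          (simp add: eQ)
      then have "h s *\<^sub>R Q (B (e 1 s)) = \<kappa> j s *\<^sub>R e (Suc j) s - \<kappa> i s *\<^sub>R e i s"
        using frenet[OF j(1) s] vector_derivative_unique_at Suc by fastforce
      then show ?thesis
        using eR'[OF s] by (simp add: R_def scaleR_add_right)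
    qed
    define \<phi> where "\<phi> s = R (e 1 s) \<bullet> e (Suc j) s" for s
    have kphi: "\<kappa> j s = h s * \<phi> s" if s: "s \<in> I" for s
      using arg_cong[OF step[OF s], of "\<lambda>x. x \<bullet> e (Suc j) s"] orthonormal[OF s j(2) j(2)]
      by (simp add: \<phi>_def)
    have Rphi: "R (e 1 s) = \<phi> s *\<^sub>R e (Suc j) s" if s: "s \<in> I" for s
    proof -
      have "h s *\<^sub>R R (e 1 s) = h s *\<^sub>R (\<phi> s *\<^sub>R e (Suc j) s)"
        using step[OF s] by (simp add: kphi[OF s])
      then show ?thesis using h[OF s] by (metis scaleR_cancel_left)
    qed
    obtain s0 where s0: "s0 \<in> I" using nonempty_I by blast
    \<comment> \<open>The square of \<phi> is the squared length of \<open>R (e 1 s)\<close>, whose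
      derivative vanishes since \<open>R\<close> commutes with the skew map
      \<open>B\<close>.\<close>
    have phi2: "\<phi> s * \<phi> s = \<phi> s0 * \<phi> s0" if s: "s \<in> I" for s
    proof -
      have "((\<lambda>s. R (e 1 s) \<bullet> R (e 1 s)) has_vector_derivative 0) (at t)" if t: "t \<in> I" for t
      proof -
        have "((\<lambda>s. R (e 1 s) \<bullet> R (e 1 s)) has_vector_derivative
            R (e 1 t) \<bullet> (h t *\<^sub>R R (B (e 1 t))) + (h t *\<^sub>R R (B (e 1 t))) \<bullet> R (e 1 t)) (at t)"
          by (rule bounded_bilinear.has_vector_derivative[OF bounded_bilinear_inner]) (rule derL[OF linR t])+
        then show ?thesis
          using skew[of "R (e 1 t)" "R (e 1 t)"] by (simp add: comm inner_commute)
      qed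
      from constant_of_zero_derivative[OF this s s0] show ?thesis
        unfolding Rphi[OF s] Rphi[OF s0] by (simp add: orthonormal[OF s j(2) j(2)] orthonormal[OF s0 j(2) j(2)])
    qed
    have "continuous_on I (\<lambda>s. R (e 1 s))"
      using derL[OF linR] by (intro continuous_at_imp_continuous_on ballI)
        (blast intro: has_vector_derivative_continuous)
    then have "continuous_on I \<phi>"
      unfolding \<phi>_def using e_continuous[OF j(2)] by (intro continuous_intros)
    \<comment> \<open>A continuous function with at most two values on a connected set is constant,
      which settles the sign.\<close>
    moreover have "finite (\<phi> ` I)"
    proof (rule finite_subset)
      show "\<phi> ` I \<subseteq> {\<phi> s0, - \<phi> s0}"
        using phi2 by (auto simp: square_eq_iff)
    qed simp
    ultimately have "\<phi> constant_on I"
      using connected_I continuous_finite_range_constant by blast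
    then obtain d where d: "\<And>s. s \<in> I \<Longrightarrow> \<phi> s = d" by (auto simp: constant_on_def)
    have d0: "d \<noteq> 0" using kappa_nonzero[OF j(3) s0] kphi[OF s0] d[OF s0] by simp
    show ?thesis
    proof (intro exI[of _ "\<lambda>x. (1 / d) *\<^sub>R R x"] exI[of _ d] conjI allI ballI)
      show "linear (\<lambda>x. (1 / d) *\<^sub>R R x)" by (rule linear_compose_scale_right[OF linR])
      show "(1 / d) *\<^sub>R R (B x) = B ((1 / d) *\<^sub>R R x)" for x
        by (simp only: comm linear_scale[OF lin])
      show "e (Suc j) s = (1 / d) *\<^sub>R R (e 1 s)" if "s \<in> I" for s
        using Rphi[OF that] d[OF that] d0 by simp
      show "\<kappa> j s = d * h s" if "s \<in> I" for s
        using kphi[OF that] d[OF that] by simp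
    qed
  qed
qed

text \<open>The tangent is an orbit, with time change \<open>g\<close>, of the rotation group
  generated by \<open>B\<close>, which turns the i-th coordinate plane with speed \<open>m i\<close>
  and annihilates the last coordinate in odd dimension. Comparing coordinates gives the equation
  that \<open>curvature_ratios_of_rotation\<close> needs.\<close>

lemma constant_ratios_of_torus_curve:
  fixes b :: "nat \<Rightarrow> 'a" and r m :: "nat \<Rightarrow> real"
  assumes on: "\<And>i j. i \<in> {1..DIM('a)} \<Longrightarrow> j \<in> {1..DIM('a)} \<Longrightarrow> b i \<bullet> b j = (if i = j then 1 else 0)"
    and g: "\<And>s. s \<in> I \<Longrightarrow> (g has_real_derivative h s) (at s)"
    and h: "\<And>s. s \<in> I \<Longrightarrow> h s \<noteq> 0"
    and torus: "\<And>s i. s \<in> I \<Longrightarrow> i \<in> {1..DIM('a) div 2} \<Longrightarrow>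
      e 1 s \<bullet> b (2 * i - 1) = r i * cos (m i * g s) \<and> e 1 s \<bullet> b (2 * i) = r i * sin (m i * g s)"
    and last: "\<And>s. s \<in> I \<Longrightarrow> odd DIM('a) \<Longrightarrow> e 1 s \<bullet> b DIM('a) = a"
    and i: "i \<in> {1..DIM('a) - 2}"
  shows "(\<lambda>s. \<kappa> (i + 1) s / \<kappa> i s) constant_on I"
proof -
  let ?k = "DIM('a) div 2"
  define B where "B x = (\<Sum>i\<in>{1..?k}. m i *\<^sub>R
    ((x \<bullet> b (2 * i - 1)) *\<^sub>R b (2 * i) - (x \<bullet> b (2 * i)) *\<^sub>R b (2 * i - 1)))" for x
  have lin: "linear B"
    by (rule linearI)
      (simp_all add: B_def inner_add_left algebra_simps scaleR_sum_right flip: sum.distrib sum_subtractf)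
  have skew: "B x \<bullet> y = - (x \<bullet> B y)" for x y
    unfolding B_def inner_sum_left inner_sum_right sum_negf[symmetric]
    by (rule sum.cong) (auto simp: inner_diff_left inner_diff_right inner_commute algebra_simps)
  have B_even: "B x \<bullet> b (2 * l) = m l * (x \<bullet> b (2 * l - 1))"
    and B_odd: "B x \<bullet> b (2 * l - 1) = - (m l * (x \<bullet> b (2 * l)))" if l: "l \<in> {1..?k}" for x l
  proof -
    have o: "b (2 * i) \<bullet> b (2 * l) = (if i = l then 1 else 0) \<and>
      b (2 * i - 1) \<bullet> b (2 * l - 1) = (if i = l then 1 else 0) \<and>
      b (2 * i) \<bullet> b (2 * l - 1) = 0 \<and> b (2 * i - 1) \<bullet> b (2 * l) = 0" if i: "i \<in> {1..?k}" for i
    proof -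
      have "2 * i \<in> {1..DIM('a)}" "2 * i - 1 \<in> {1..DIM('a)}" "2 * l \<in> {1..DIM('a)}" "2 * l - 1 \<in> {1..DIM('a)}"
        using i l by auto
      moreover have "2 * i \<noteq> 2 * l - 1" "2 * i - 1 \<noteq> 2 * l" "2 * i - 1 = 2 * l - 1 \<longleftrightarrow> i = l"
        using i l by (auto, presburger+)
      ultimately show ?thesis by (simp add: on)
    qed
    have "B x \<bullet> b (2 * l) = (\<Sum>i\<in>{1..?k}. if i = l then m i * (x \<bullet> b (2 * i - 1)) else 0)"
      unfolding B_def inner_sum_left by (intro sum.cong refl) (simp add: o[unfolded One_nat_def] inner_diff_left)
    then show "B x \<bullet> b (2 * l) = m l * (x \<bullet> b (2 * l - 1))"
      using l by (simp only: sum.delta finite_atLeastAtMost if_True)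
    have "B x \<bullet> b (2 * l - 1) = (\<Sum>i\<in>{1..?k}. if i = l then - (m i * (x \<bullet> b (2 * i))) else 0)"
      unfolding B_def inner_sum_left by (intro sum.cong refl) (simp add: o[unfolded One_nat_def] inner_diff_left)
    then show "B x \<bullet> b (2 * l - 1) = - (m l * (x \<bullet> b (2 * l)))"
      using l by (simp only: sum.delta finite_atLeastAtMost if_True)
  qed
  have B_last: "B x \<bullet> b DIM('a) = 0" if "odd DIM('a)" for x
  proof -
    have "b (2 * i) \<bullet> b DIM('a) = 0 \<and> b (2 * i - 1) \<bullet> b DIM('a) = 0" if i: "i \<in> {1..?k}" for i
    proof -
      have "2 * i \<in> {1..DIM('a)}" "2 * i - 1 \<in> {1..DIM('a)}" "DIM('a) \<in> {1..DIM('a)}"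
        using i dim2 by auto
      moreover have "2 * i \<noteq> DIM('a)"
        using \<open>odd DIM('a)\<close> by (metis dvd_triv_left)
      moreover have "2 * i - 1 \<noteq> DIM('a)"
        using i by auto
      ultimately show ?thesis by (simp add: on)
    qed
    then show ?thesis by (simp add: B_def inner_sum_left inner_diff_left)
  qed
  have der: "(e 1 has_vector_derivative h s *\<^sub>R B (e 1 s)) (at s)" if s: "s \<in> I" for s
  proof -
    obtain D where D: "(e 1 has_vector_derivative D) (at s)"
      using frenet[of 1 s] dim2 s by auto
    \<comment> \<open>The torus equations hold on \<open>I\<close> only, so the explicit functions
      are substituted on that open set; uniqueness of derivatives then reads off the coordinates of
      \<open>D\<close>.\<close>
    have coord: "D \<bullet> w = d" if d: "(f has_real_derivative d) (at s)" "\<And>t. t \<in> I \<Longrightarrow> e 1 t \<bullet> w = f t" for w f d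
    proof -
      have "((\<lambda>t. e 1 t \<bullet> w) has_real_derivative D \<bullet> w) (at s)"
        using bounded_linear.has_vector_derivative[OF bounded_linear_inner_left D]
        by (simp add: has_real_derivative_iff_has_vector_derivative)
      moreover have "((\<lambda>t. e 1 t \<bullet> w) has_real_derivative d) (at s)"
        using d(2) by (intro has_field_derivative_transform_within_open[OF d(1) open_I s]) simp
      ultimately show ?thesis by (rule DERIV_unique)
    qed
    have "D - h s *\<^sub>R B (e 1 s) = 0"
    proof (rule orthonormal_eq_0[of b, OF on])
      fix j assume j: "j \<in> {1..DIM('a)}"
      consider l where "l \<in> {1..?k}" "j = 2 * l" | l where "l \<in> {1..?k}" "j = 2 * l - 1"
        | "odd DIM('a)" "j = DIM('a)"
      proof (cases "even j")
        case True
        then show ?thesis using that(1)[of "j div 2"] j by auto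
      next
        case False
        then show ?thesis
          using that(2)[of "(j + 1) div 2"] that(3) j by (cases "j = DIM('a)") (auto elim!: oddE)
      qed
      then show "(D - h s *\<^sub>R B (e 1 s)) \<bullet> b j = 0"
      proof cases
        case (1 l)
        have "D \<bullet> b j = r l * (cos (m l * g s) * (m l * h s))"
          by (rule coord[of "\<lambda>t. r l * sin (m l * g t)"])
            (use torus 1 in \<open>auto intro!: derivative_eq_intros g s\<close>)
        then show ?thesis using torus[OF s 1(1)] 1 by (simp add: inner_diff_left B_even)
      next
        case (2 l)
        have "D \<bullet> b j = - (r l * (sin (m l * g s) * (m l * h s)))"
          by (rule coord[of "\<lambda>t. r l * cos (m l * g t)"])
            (use torus 2 in \<open>auto intro!: derivative_eq_intros g s\<close>)
        then show ?thesis using torus[OF s 2(1)] B_odd[OF 2(1)] by (simp add: 2(2) inner_diff_left)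
      next
        case 3
        have "D \<bullet> b j = 0"
          by (rule coord[of "\<lambda>_. a"]) (use last 3 in auto)
        then show ?thesis using 3 by (simp add: inner_diff_left B_last)
      qed
    qed
    then show ?thesis using D by simp
  qed
  have "i < DIM('a)" "i + 1 < DIM('a)" using i by auto
  then obtain c c' where "\<forall>s\<in>I. \<kappa> i s = c * h s" "\<forall>s\<in>I. \<kappa> (i + 1) s = c' * h s"
    using curvature_ratios_of_rotation[OF lin skew der h] by metis
  then have "\<forall>s\<in>I. \<kappa> (i + 1) s / \<kappa> i s = c' / c"
    using h by simp
  then show ?thesis by (auto simp: constant_on_def)
qed

end

section \<open>Frenet equations\<close>

lemma pos_mem: "pos (q::'n::{finite,linorder}) \<in> {1..CARD('n)}"
  using bij_betw_pos[where 'n='n] by (auto simp: bij_betw_def)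

lemma pos_eq_iff: "pos (p::'n::{finite,linorder}) = pos q \<longleftrightarrow> p = q"
  using bij_betw_pos[where 'n='n] by (auto simp: bij_betw_def inj_eq)

lemma ex_pos:
  assumes "i \<in> {1..CARD('n)}"
  obtains q :: "'n::{finite,linorder}" where "pos q = i"
  using assms bij_betw_imp_surj_on[OF bij_betw_pos[where 'n='n]] by (metis imageE)

lemma nth_deriv_has_vector_derivative:
  assumes "regular_curve I \<alpha>" and "s \<in> I" and "l < CARD('n)"
  shows "(nth_deriv l (\<alpha> :: real \<Rightarrow> real ^ 'n) has_vector_derivative nth_deriv (Suc l) \<alpha> s) (at s)"
  using assms vector_derivative_works
  by (auto simp: regular_curve_def C_n_on_def nth_deriv_def)

lemma frenet_frame_orthonormal:
  fixes \<alpha> :: "real \<Rightarrow> real ^ 'n::{finite,linorder}"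
  assumes "regular_curve I \<alpha>" and "s \<in> I" and "i \<in> {1..CARD('n)}" and "j \<in> {1..CARD('n)}"
  shows "frenet_frame \<alpha> i s \<bullet> frenet_frame \<alpha> j s = (if i = j then 1 else 0)"
  using frenet_frame_positive_onb[OF assms(1,2)] assms(3,4) unfolding positive_onb_def by blast

lemma span_frenet_frame:
  fixes \<alpha> :: "real \<Rightarrow> real ^ 'n::{finite,linorder}"
  assumes "regular_curve I \<alpha>" and "s \<in> I" and "m \<le> CARD('n)"
  shows "span ((\<lambda>i. frenet_frame \<alpha> i s) ` {1..<m}) = span ((\<lambda>i. nth_deriv i \<alpha> s) ` {1..<m})"
proof -
  have "inj_on (\<lambda>j. nth_deriv j \<alpha> s) {1..<CARD('n)}"
    "independent ((\<lambda>j. nth_deriv j \<alpha> s) ` {1..<CARD('n)})"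
    using assms by (simp_all add: regular_curve_def)
  then have "span (gram_schmidt (\<lambda>j. nth_deriv j \<alpha> s) ` {1..<m}) = span ((\<lambda>i. nth_deriv i \<alpha> s) ` {1..<m})"
    using gram_schmidt_orthonormal assms(3) by blast
  moreover have "(\<lambda>i. frenet_frame \<alpha> i s) ` {1..<m} = gram_schmidt (\<lambda>j. nth_deriv j \<alpha> s) ` {1..<m}"
    using assms(3) by (intro image_cong) (auto simp: frenet_frame_def)
  ultimately show ?thesis by simp
qed

lemma inner_eq_0_span: "x \<in> span S \<Longrightarrow> (\<And>y. y \<in> S \<Longrightarrow> w \<bullet> y = 0) \<Longrightarrow> w \<bullet> x = 0"
  using orthogonal_to_span[of x S w] by (simp add: orthogonal_def)

text \<open>The l-th derivative lies in the span of the first \<open>l\<close> frame vectors; the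
  case \<open>j = CARD('n)\<close> covers the vector that is not produced by Gram-Schmidt.\<close>

lemma frenet_frame_perp_nth_deriv:
  fixes \<alpha> :: "real \<Rightarrow> real ^ 'n::{finite,linorder}"
  assumes "regular_curve I \<alpha>" and "s \<in> I" and "1 \<le> l" and "l < j" and "j \<le> CARD('n)"
  shows "frenet_frame \<alpha> j s \<bullet> nth_deriv l \<alpha> s = 0"
proof (rule inner_eq_0_span)
  have "nth_deriv l \<alpha> s \<in> span ((\<lambda>i. nth_deriv i \<alpha> s) ` {1..<Suc l})"
    using assms by (intro span_base) auto
  also have "\<dots> = span ((\<lambda>i. frenet_frame \<alpha> i s) ` {1..<Suc l})"
    using assms by (intro span_frenet_frame[symmetric]) auto
  finally show "nth_deriv l \<alpha> s \<in> span ((\<lambda>i. frenet_frame \<alpha> i s) ` {1..<Suc l})" .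
  show "frenet_frame \<alpha> j s \<bullet> y = 0" if "y \<in> (\<lambda>i. frenet_frame \<alpha> i s) ` {1..<Suc l}" for y
    using that assms by (auto simp: frenet_frame_orthonormal)
qed

text \<open>The derivatives of order below \<open>CARD('n)\<close> are differentiable, and
  Gram-Schmidt combines them with earlier frame vectors by smooth operations as long as the residual
  \<open>w\<close> does not vanish.\<close>

lemma differentiable_frenet_frame_less:
  fixes \<alpha> :: "real \<Rightarrow> real ^ 'n::{finite,linorder}"
  assumes reg: "regular_curve I \<alpha>" and s: "s \<in> I"
  shows "1 \<le> i \<Longrightarrow> i < CARD('n) \<Longrightarrow> frenet_frame \<alpha> i differentiable (at s)"
proof (induction i rule: less_induct)
  case (less i)
  let ?e = "frenet_frame \<alpha>"
  define w where "w t = nth_deriv i \<alpha> t - (\<Sum>j\<in>{1..<i}. (nth_deriv i \<alpha> t \<bullet> ?e j t) *\<^sub>R ?e j t)" for t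
  have e: "?e i = (\<lambda>t. sgn (w t))"
  proof
    fix t
    have "?e i t = gram_schmidt (\<lambda>j. nth_deriv j \<alpha> t) i"
      using less.prems by (simp add: frenet_frame_def)
    also have "\<dots> = sgn (w t)"
      unfolding w_def using less.prems
      by (subst gram_schmidt.simps) (simp add: frenet_frame_def)
    finally show "?e i t = sgn (w t)" .
  qed
  have "nth_deriv i \<alpha> differentiable (at s)"
    using nth_deriv_has_vector_derivative[OF reg s less.prems(2)] differentiableI_vector by blast
  then have w: "w differentiable (at s)"
    unfolding w_def[abs_def] using less
    by (intro differentiable_diff differentiable_sum differentiable_scaleR differentiable_inner ballI) auto
  \<comment> \<open>Since \<open>sgn 0 = 0\<close>, the unit length of the frame vector excludes a
    zero residual.\<close>
  have "?e i s \<bullet> ?e i s = 1"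
    using less.prems by (simp add: frenet_frame_orthonormal[OF reg s])
  then have "w s \<noteq> 0" by (auto simp: e)
  then have "(\<lambda>t. inverse (norm (w t)) *\<^sub>R w t) differentiable (at s)"
    using differentiable_compose[OF differentiable_norm_at w] w
    by (intro differentiable_scaleR differentiable_inverse) auto
  then show ?case by (simp add: e sgn_div_norm)
qed

text \<open>
  Cramer's rule: pairing with the last vector of a positive orthonormal basis amounts to
  replacing it in the determinant, so it depends polynomially on the other ones.
\<close>

lemma positive_onb_last:
  fixes b :: "nat \<Rightarrow> real ^ 'n::{finite,linorder}"
  assumes b: "positive_onb b" and z: "pos z = CARD('n)"
  shows "det (\<chi> q. if q = z then x else b (pos q)) = x \<bullet> b CARD('n)"
proof -
  let ?n = "CARD('n)"
  have on: "b i \<bullet> b j = (if i = j then 1 else 0)" if "i \<in> {1..?n}" "j \<in> {1..?n}" for i j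
    using b that unfolding positive_onb_def by blast
  define E :: "((real, 'n) vec, 'n) vec" where "E = (\<chi> q. b (pos q))"
  have "E ** transpose E = mat 1"
    using on[OF pos_mem pos_mem]
    by (simp add: pos_eq_iff vec_eq_iff matrix_matrix_mult_def transpose_def mat_def E_def inner_vec_def)
  then have "orthogonal_matrix E"
    by (simp add: orthogonal_matrix_def matrix_left_right_inverse)
  then have "det E = 1 \<or> det E = -1" by (rule det_orthogonal_matrix)
  moreover have "det E > 0"
  proof -
    have "transpose E = (\<chi> p q. b (pos q) $ p)" by (simp add: E_def transpose_def vec_eq_iff)
    then show ?thesis using b det_transpose[of E] by (simp add: positive_onb_def)
  qed
  ultimately have detE: "det E = 1" by linarith
  \<comment> \<open>The part of \<open>x\<close> along the other basis vectors; it lies in the span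
    of the other rows and leaves the determinant unchanged.\<close>
  define y where "y = (\<Sum>i\<in>{1..<?n}. (x \<bullet> b i) *\<^sub>R b i)"
  have n1: "?n \<ge> 1" by (simp add: Suc_le_eq)
  have "x = (\<Sum>i=1..?n. (x \<bullet> b i) *\<^sub>R b i)"
    using orthonormal_expand[of b x] on by simp
  also have "{1..?n} = insert ?n {1..<?n}" using n1 by auto
  finally have x: "x = (x \<bullet> b ?n) *\<^sub>R b ?n + y" by (simp add: y_def)
  define A :: "((real, 'n) vec, 'n) vec" where "A = (\<chi> q. if q = z then (x \<bullet> b ?n) *s b ?n else b (pos q))"
  have "y \<in> vec.span {row j A |j. j \<noteq> z}"
    unfolding y_def
  proof (rule vec.span_sum)
    fix i assume i: "i \<in> {1..<?n}"
    then have "i \<in> {1..?n}" by auto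
    then obtain q :: 'n where q: "pos q = i" by (rule ex_pos)
    then have "q \<noteq> z" using i z by auto
    then have "b i = row q A" using q by (simp add: A_def row_def vec_eq_iff)
    then show "(x \<bullet> b i) *\<^sub>R b i \<in> vec.span {row j A |j. j \<noteq> z}"
      using \<open>q \<noteq> z\<close> unfolding scalar_mult_eq_scaleR[symmetric]
      by (intro vec.span_scale vec.span_base) blast
  qed
  then have "det (\<chi> q. if q = z then row z A + y else row q A) = det A"
    by (rule det_row_span)
  moreover have "(\<chi> q. if q = z then row z A + y else row q A) = (\<chi> q. if q = z then x else b (pos q))"
    using x by (simp add: A_def row_def vec_eq_iff)
  moreover have "det A = (x \<bullet> b ?n) * det (\<chi> q. if q = z then b ?n else b (pos q))"
    unfolding A_def by (rule det_row_mul)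
  moreover have "(\<chi> q. if q = z then b ?n else b (pos q)) = E"
    using z by (auto simp: E_def vec_eq_iff)
  ultimately show ?thesis using detE by simp
qed

lemma differentiable_prod_real:
  fixes f :: "'i \<Rightarrow> real \<Rightarrow> real"
  shows "(\<And>i. i \<in> S \<Longrightarrow> f i differentiable (at s)) \<Longrightarrow> (\<lambda>t. \<Prod>i\<in>S. f i t) differentiable (at s)"
  by (induction S rule: infinite_finite_induct) (auto intro: differentiable_mult)

text \<open>The last vector is given by a definite description, so it is differentiated
  coordinatewise: by \<open>positive_onb_last\<close> each of its coordinates agrees on
  \<open>I\<close> with a determinant whose remaining rows are the differentiable vectors before
  it.\<close>

lemma differentiable_frenet_frame:
  fixes \<alpha> :: "real \<Rightarrow> real ^ 'n::{finite,linorder}"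
  assumes op: "open I" and reg: "regular_curve I \<alpha>" and s: "s \<in> I" and i: "i \<in> {1..CARD('n)}"
  shows "frenet_frame \<alpha> i differentiable (at s)"
proof (cases "i < CARD('n)")
  case True
  then show ?thesis using differentiable_frenet_frame_less[OF reg s] i by auto
next
  case False
  let ?e = "frenet_frame \<alpha>"
  have "CARD('n) \<in> {1..CARD('n)}" by (simp add: Suc_le_eq)
  then obtain z :: 'n where z: "pos z = CARD('n)" by (rule ex_pos)
  have comp: "(\<lambda>t. ?e i t \<bullet> x) differentiable (at s)" for x
  proof -
    define A :: "real \<Rightarrow> ((real, 'n) vec, 'n) vec" where "A t = (\<chi> q. if q = z then x else ?e (pos q) t)" for t
    have entry: "(\<lambda>t. A t $ q $ p) differentiable (at s)" for q p
    proof (cases "q = z")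
      case True
      then show ?thesis by (simp add: A_def)
    next
      case False
      have "pos q \<noteq> CARD('n)"
        using False unfolding z[symmetric] by (simp add: pos_eq_iff)
      then have "pos q \<in> {1..<CARD('n)}"
        using pos_mem[of q] by simp
      then have "?e (pos q) differentiable (at s)"
        by (intro differentiable_frenet_frame_less[OF reg s]) auto
      then have "(\<lambda>t. ?e (pos q) t \<bullet> axis p 1) differentiable (at s)"
        by (intro differentiable_inner) auto
      then show ?thesis using False by (simp add: A_def inner_axis)
    qed
    have "(\<lambda>t. det (A t)) differentiable (at s)"
      unfolding det_def
      by (intro differentiable_sum ballI differentiable_mult differentiable_prod_real entry) auto
    then obtain d where d: "((\<lambda>t. det (A t)) has_derivative d) (at s)"
      by (auto simp: differentiable_def)
    have "((\<lambda>t. ?e i t \<bullet> x) has_derivative d) (at s)"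
    proof (rule has_derivative_transform_within_open[OF d op s])
      fix t assume "t \<in> I"
      then show "det (A t) = ?e i t \<bullet> x"
        unfolding A_def using positive_onb_last[OF frenet_frame_positive_onb[OF reg] z] False i
        by (simp add: inner_commute)
    qed
    then show ?thesis by (auto simp: differentiable_def)
  qed
  then show ?thesis
    by (subst differentiable_componentwise_within) blast
qed

text \<open>The coefficients of the derivative of the frame are skew-symmetric because the frame is
  orthonormal, and tridiagonal by \<open>low\<close>; the entries next to the diagonal are the
  curvatures since the speed is 1.\<close>

lemma frenet_equations:
  fixes \<alpha> :: "real \<Rightarrow> real ^ 'n::{finite,linorder}"
  assumes op: "open I" and reg: "regular_curve I \<alpha>"
    and unit: "\<forall>s\<in>I. norm (vector_derivative \<alpha> (at s)) = 1"
    and s: "s \<in> I" and i: "i \<in> {1..CARD('n)}"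
    and k: "\<And>i. \<kappa> i = (if i \<in> {1..<CARD('n)} then curvature \<alpha> i s else 0)"
  shows "(frenet_frame \<alpha> i has_vector_derivative
    \<kappa> i *\<^sub>R frenet_frame \<alpha> (Suc i) s - \<kappa> (i - 1) *\<^sub>R frenet_frame \<alpha> (i - 1) s) (at s)"
proof -
  let ?n = "CARD('n)"
  let ?e = "frenet_frame \<alpha>"
  define D where "D i = vector_derivative (?e i) (at s)" for i
  have D: "(?e i has_vector_derivative D i) (at s)" if "i \<in> {1..?n}" for i
    using differentiable_frenet_frame[OF op reg s that] by (simp add: D_def vector_derivative_works)
  have on: "?e i t \<bullet> ?e j t = (if i = j then 1 else 0)"
    if "t \<in> I" "i \<in> {1..?n}" "j \<in> {1..?n}" for t i j
    by (rule frenet_frame_orthonormal[OF reg that])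
  have zero: "f s \<bullet> h' + f' \<bullet> h s = 0"
    if "(f has_vector_derivative f') (at s)" "(h has_vector_derivative h') (at s)"
      "\<And>t. t \<in> I \<Longrightarrow> f t \<bullet> h t = c" for f h :: "real \<Rightarrow> (real, 'n) vec" and f' h' c
  proof -
    have "((\<lambda>t. f t \<bullet> h t) has_vector_derivative f s \<bullet> h' + f' \<bullet> h s) (at s)"
      by (rule bounded_bilinear.has_vector_derivative[OF bounded_bilinear_inner that(1,2)])
    moreover have "((\<lambda>t. f t \<bullet> h t) has_vector_derivative 0) (at s)"
      by (rule has_vector_derivative_transform_within_open[OF has_vector_derivative_const op s])
        (simp add: that(3))
    ultimately show ?thesis by (rule vector_derivative_unique_at)
  qed
  have skew: "D i \<bullet> ?e j s = - (D j \<bullet> ?e i s)" if "i \<in> {1..?n}" "j \<in> {1..?n}" for i j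
    using zero[OF D[OF that(1)] D[OF that(2)] on[OF _ that]] by (simp add: inner_commute)
  \<comment> \<open>Differentiate the orthogonality of \<open>e j\<close> to the l-th derivative:
    the product of \<open>D j\<close> with that derivative is minus the product of
    \<open>e j\<close> with the next one, which is again zero because \<open>l + 1 < j\<close>. No
    derivative of order above \<open>CARD('n) - 1\<close> enters.\<close>
  have low: "D j \<bullet> ?e i s = 0" if i: "i \<in> {1..?n}" and j: "j \<in> {1..?n}" and ij: "Suc i < j" for i j
  proof (rule inner_eq_0_span)
    have "?e i s \<in> span ((\<lambda>i. ?e i s) ` {1..<Suc i})"
      using i by (intro span_base) auto
    then show "?e i s \<in> span ((\<lambda>i. nth_deriv i \<alpha> s) ` {1..<Suc i})"
      using span_frenet_frame[OF reg s, of "Suc i"] ij j by auto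
    fix y assume "y \<in> (\<lambda>i. nth_deriv i \<alpha> s) ` {1..<Suc i}"
    then obtain l where l: "1 \<le> l" "l \<le> i" "y = nth_deriv l \<alpha> s" by auto
    have "?e j s \<bullet> nth_deriv (Suc l) \<alpha> s + D j \<bullet> nth_deriv l \<alpha> s = 0"
    proof (rule zero[OF D[OF j] nth_deriv_has_vector_derivative[OF reg s]])
      show "l < ?n" using l ij j by auto
      show "?e j t \<bullet> nth_deriv l \<alpha> t = 0" if "t \<in> I" for t
        using l ij j by (intro frenet_frame_perp_nth_deriv[OF reg that]) auto
    qed
    moreover have "?e j s \<bullet> nth_deriv (Suc l) \<alpha> s = 0"
      using l ij j by (intro frenet_frame_perp_nth_deriv[OF reg s]) auto
    ultimately show "D j \<bullet> y = 0" by (simp add: l)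
  qed
  have curv: "D i \<bullet> ?e (Suc i) s = \<kappa> i" if "i \<in> {1..<?n}" for i
    using that unit s by (simp add: k curvature_def D_def)
  have "D i - (\<kappa> i *\<^sub>R ?e (Suc i) s - \<kappa> (i - 1) *\<^sub>R ?e (i - 1) s) = 0"
  proof (rule orthonormal_eq_0[of "\<lambda>j. ?e j s"])
    show "?e i s \<bullet> ?e j s = (if i = j then 1 else 0)"
      if "i \<in> {1..DIM((real, 'n) vec)}" "j \<in> {1..DIM((real, 'n) vec)}" for i j
      using on[OF s] that by simp
    fix j assume "j \<in> {1..DIM((real, 'n) vec)}"
    then have j: "j \<in> {1..?n}" by simp
    \<comment> \<open>For \<open>i = CARD('n)\<close> the index \<open>Suc i\<close> leaves the
      frame, and the zero value of \<kappa> takes over. In \<open>down\<close>, the form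
      \<open>Suc j = i\<close> avoids truncated subtraction at \<open>i = 1\<close>.\<close>
    have up: "\<kappa> i * (?e (Suc i) s \<bullet> ?e j s) = (if j = Suc i then \<kappa> i else 0)"
    proof (cases "i = ?n")
      case True
      then show ?thesis by (simp add: k)
    next
      case False
      then show ?thesis using on[OF s _ j, of "Suc i"] i by auto
    qed
    have down: "\<kappa> (i - 1) * (?e (i - 1) s \<bullet> ?e j s) = (if Suc j = i then \<kappa> (i - 1) else 0)"
    proof (cases "i = 1")
      case True
      then show ?thesis using j by (simp add: k)
    next
      case False
      then have "i - 1 \<in> {1..?n}" using i by auto
      from on[OF s this j] show ?thesis using False i by auto
    qed
    consider "Suc i < j" | "j = Suc i" | "j = i" | "i = Suc j" | "Suc j < i" by linarith
    then have "D i \<bullet> ?e j s = (if j = Suc i then \<kappa> i else 0) - (if Suc j = i then \<kappa> (i - 1) else 0)"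
    proof cases
      case 1
      then show ?thesis using skew[OF i j] low[OF i j] by simp
    next
      case 2
      then show ?thesis using curv[of i] i j by simp
    next
      case 3
      then show ?thesis using skew[OF i i] by simp
    next
      case 4
      then show ?thesis using skew[OF i j] curv[of j] i j by simp
    next
      case 5
      then show ?thesis using low[OF j i] by simp
    qed
    then show "(D i - (\<kappa> i *\<^sub>R ?e (Suc i) s - \<kappa> (i - 1) *\<^sub>R ?e (i - 1) s)) \<bullet> ?e j s = 0"
      by (simp add: inner_diff_left up[symmetric] down[symmetric])
  qed
  then show ?thesis using D[OF i] by simp
qed

text \<open>Cutting \<open>curvature\<close> off to 0 supplies the boundary values of the abstract
  system. Continuity of the first curvature comes from k_1 = \<alpha>'' . e_2, valid because e_1 =
  \<alpha>' on \<open>I\<close>.\<close>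

lemma frenet_system_frenet_frame:
  fixes \<alpha> :: "real \<Rightarrow> real ^ 'n::{finite,linorder}"
  assumes n: "CARD('n) \<ge> 2"
    and I: "open I" "is_interval I" "I \<noteq> {}"
    and reg: "regular_curve I \<alpha>"
    and unit: "\<forall>s\<in>I. norm (vector_derivative \<alpha> (at s)) = 1"
    and nonzero: "\<forall>i\<in>{1..CARD('n) - 1}. \<forall>s\<in>I. curvature \<alpha> i s \<noteq> 0"
  shows "frenet_system I (frenet_frame \<alpha>) (\<lambda>i s. if i \<in> {1..<CARD('n)} then curvature \<alpha> i s else 0)"
    (is "frenet_system I ?e ?k")
proof
  have eqs: "(?e i has_vector_derivative ?k i s *\<^sub>R ?e (Suc i) s - ?k (i - 1) s *\<^sub>R ?e (i - 1) s) (at s)"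
    if "i \<in> {1..CARD('n)}" "s \<in> I" for i s
    by (rule frenet_equations[OF I(1) reg unit that(2,1)]) simp
  then show "(?e i has_vector_derivative ?k i s *\<^sub>R ?e (Suc i) s - ?k (i - 1) s *\<^sub>R ?e (i - 1) s) (at s)"
    if "i \<in> {1..DIM((real, 'n) vec)}" "s \<in> I" for i s
    using that by simp
  have e1: "?e 1 s = nth_deriv 1 \<alpha> s" if "s \<in> I" for s
  proof -
    have "gram_schmidt v 1 = sgn (v 1)" for v :: "nat \<Rightarrow> (real, 'n) vec"
      by (subst gram_schmidt.simps) simp
    then have "?e 1 s = sgn (nth_deriv 1 \<alpha> s)"
      using n by (simp add: frenet_frame_def)
    moreover have "norm (nth_deriv 1 \<alpha> s) = 1"
      using unit that by (simp add: nth_deriv_def)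
    ultimately show ?thesis by (simp add: sgn_div_norm)
  qed
  have e1': "(?e 1 has_vector_derivative nth_deriv 2 \<alpha> s) (at s)" if s: "s \<in> I" for s
    using has_vector_derivative_transform_within_open[OF nth_deriv_has_vector_derivative[OF reg s, of 1] I(1) s]
      e1 n by (simp add: numeral_2_eq_2)
  \<comment> \<open>For n = 2 this is the derivative of top order, continuous by
    \<open>C_n_on\<close>; for larger n it is even differentiable.\<close>
  have "continuous_on I (nth_deriv 2 \<alpha>)"
  proof (cases "CARD('n) = 2")
    case True
    then show ?thesis using reg by (simp add: regular_curve_def C_n_on_def)
  next
    case False
    then have "2 < CARD('n)" using n by simp
    then show ?thesis
      using nth_deriv_has_vector_derivative[OF reg]
      by (intro continuous_at_imp_continuous_on ballI) (blast intro: has_vector_derivative_continuous)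
  qed
  moreover have "continuous_on I (?e 2)"
    using eqs[of 2] n
    by (intro continuous_at_imp_continuous_on ballI) (auto intro: has_vector_derivative_continuous)
  ultimately have "continuous_on I (\<lambda>s. nth_deriv 2 \<alpha> s \<bullet> ?e 2 s)"
    by (intro continuous_intros)
  moreover have "nth_deriv 2 \<alpha> s \<bullet> ?e 2 s = ?k 1 s" if s: "s \<in> I" for s
    using vector_derivative_at[OF e1'[OF s]] n unit s by (simp add: curvature_def numeral_2_eq_2)
  ultimately show "continuous_on I (?k 1)" by (simp cong: continuous_on_cong)
  show "?e i s \<bullet> ?e j s = (if i = j then 1 else 0)"
    if "s \<in> I" "i \<in> {1..DIM((real, 'n) vec)}" "j \<in> {1..DIM((real, 'n) vec)}" for s i j
    using frenet_frame_orthonormal[OF reg] that by simp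
qed (use n I nonzero in auto)

section \<open>Coordinates on flat tori\<close>

text \<open>Translates between the isometry \<open>A\<close> and an adapted orthonormal basis: the
  coordinates of \<open>A *v x\<close> are the inner products of \<open>x\<close> with the
  rows.\<close>

lemma orthogonal_matrix_rows:
  fixes b :: "nat \<Rightarrow> real ^ 'n::{finite,linorder}"
  shows "orthogonal_matrix (\<chi> p. b (pos p)) \<longleftrightarrow>
    (\<forall>i\<in>{1..CARD('n)}. \<forall>j\<in>{1..CARD('n)}. b i \<bullet> b j = (if i = j then 1 else 0))"
proof -
  let ?A = "(\<chi> p. b (pos p)) :: ((real, 'n) vec, 'n) vec"
  have "orthogonal_matrix ?A \<longleftrightarrow> ?A ** transpose ?A = mat 1"
    by (auto simp: orthogonal_matrix_def matrix_left_right_inverse)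
  also have "\<dots> \<longleftrightarrow> (\<forall>p q :: 'n. b (pos p) \<bullet> b (pos q) = (if p = q then 1 else 0))"
    by (auto simp: vec_eq_iff matrix_matrix_mult_def transpose_def mat_def inner_vec_def)
  also have "\<dots> \<longleftrightarrow>
    (\<forall>i\<in>{1..CARD('n)}. \<forall>j\<in>{1..CARD('n)}. b i \<bullet> b j = (if i = j then 1 else 0))"
  proof (intro iffI ballI allI)
    fix i j assume orth: "\<forall>p q :: 'n. b (pos p) \<bullet> b (pos q) = (if p = q then 1 else 0)"
      and ij: "i \<in> {1..CARD('n)}" "j \<in> {1..CARD('n)}"
    obtain p q :: 'n where "pos p = i" "pos q = j" using ex_pos[OF ij(1)] ex_pos[OF ij(2)] by metis
    then show "b i \<bullet> b j = (if i = j then 1 else 0)" using orth pos_eq_iff[of p q] by auto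
  next
    fix p q :: 'n
    assume "\<forall>i\<in>{1..CARD('n)}. \<forall>j\<in>{1..CARD('n)}. b i \<bullet> b j = (if i = j then 1 else 0)"
    then show "b (pos p) \<bullet> b (pos q) = (if p = q then 1 else 0)"
      using pos_mem[of p] pos_mem[of q] pos_eq_iff[of p q] by simp
  qed
  finally show ?thesis .
qed

text \<open>Regroups the coordinates, which \<open>flat_torus_point\<close> sorts by the parity of
  their position, into pairs belonging to one plane; both implications of the theorem use
  it.\<close>

lemma flat_torus_geodesic_iff:
  fixes b :: "nat \<Rightarrow> real ^ 'n::{finite,linorder}"
  shows "(\<chi> p. b (pos p)) *v x = (flat_torus_geodesic r a m t :: (real, 'n) vec) \<longleftrightarrow>
    (\<forall>i\<in>{1..CARD('n) div 2}. x \<bullet> b (2 * i - 1) = r i * cos (m i * t) \<and> x \<bullet> b (2 * i) = r i * sin (m i * t)) \<and>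
    (odd CARD('n) \<longrightarrow> x \<bullet> b CARD('n) = a)"
proof -
  define T where "T j = (if odd j then (if j = CARD('n) then a else r ((j + 1) div 2) * cos (m ((j + 1) div 2) * t))
    else r (j div 2) * sin (m (j div 2) * t))" for j
  have "(\<chi> p. b (pos p)) *v x = (flat_torus_geodesic r a m t :: (real, 'n) vec) \<longleftrightarrow> (\<forall>p::'n. x \<bullet> b (pos p) = T (pos p))"
    by (simp add: vec_eq_iff matrix_vector_mult_def flat_torus_geodesic_def flat_torus_point_def T_def
        inner_vec_def mult.commute)
  also have "\<dots> \<longleftrightarrow> (\<forall>j\<in>{1..CARD('n)}. x \<bullet> b j = T j)"
    using pos_mem ex_pos by metis
  also have "\<dots> \<longleftrightarrow> (\<forall>i\<in>{1..CARD('n) div 2}. x \<bullet> b (2 * i - 1) = T (2 * i - 1) \<and> x \<bullet> b (2 * i) = T (2 * i)) \<and>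
    (odd CARD('n) \<longrightarrow> x \<bullet> b CARD('n) = T CARD('n))" (is "?L \<longleftrightarrow> ?R")
  proof
    assume L: ?L
    show ?R
    proof (intro conjI ballI impI)
      fix i assume "i \<in> {1..CARD('n) div 2}"
      then have "2 * i - 1 \<in> {1..CARD('n)}" "2 * i \<in> {1..CARD('n)}" by auto
      then show "x \<bullet> b (2 * i - 1) = T (2 * i - 1)" "x \<bullet> b (2 * i) = T (2 * i)" using L by blast+
    next
      show "x \<bullet> b CARD('n) = T CARD('n)" using L by (simp add: Suc_le_eq)
    qed
  next
    assume R: ?R
    show ?L
    proof
      fix j assume j: "j \<in> {1..CARD('n)}"
      consider "even j" | "odd j" "j \<noteq> CARD('n)" | "odd j" "j = CARD('n)" by blast
      then show "x \<bullet> b j = T j"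
      proof cases
        case 1
        then have "j div 2 \<in> {1..CARD('n) div 2}" "2 * (j div 2) = j" using j by (auto elim!: evenE)
        then show ?thesis using R by metis
      next
        case 2
        then have "(j + 1) div 2 \<in> {1..CARD('n) div 2}" "2 * ((j + 1) div 2) - 1 = j"
          using j by (auto elim!: oddE)
        then show ?thesis using R by metis
      next
        case 3
        then show ?thesis using R by blast
      qed
    qed
  qed
  also have "\<dots> \<longleftrightarrow> (\<forall>i\<in>{1..CARD('n) div 2}. x \<bullet> b (2 * i - 1) = r i * cos (m i * t) \<and> x \<bullet> b (2 * i) = r i * sin (m i * t)) \<and>
    (odd CARD('n) \<longrightarrow> x \<bullet> b CARD('n) = a)"
  proof -
    have "T (2 * i - 1) = r i * cos (m i * t)" "T (2 * i) = r i * sin (m i * t)"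
      if "i \<in> {1..CARD('n) div 2}" for i
    proof -
      have "2 * i - 1 \<noteq> CARD('n)" "odd (2 * i - 1)" "(2 * i - 1 + 1) div 2 = i"
        using that by auto
      then show "T (2 * i - 1) = r i * cos (m i * t)" by (simp only: T_def if_True if_False not_False_eq_True)
      show "T (2 * i) = r i * sin (m i * t)" by (simp add: T_def)
    qed
    moreover have "odd CARD('n) \<Longrightarrow> T CARD('n) = a" by (simp add: T_def)
    ultimately show ?thesis by metis
  qed
  finally show ?thesis .
qed

theorem theorem1:
  fixes I :: "real set" and \<alpha> :: "real \<Rightarrow> real ^ 'n::{finite,linorder}"
  assumes "CARD('n) \<ge> 2"
    and "open I" and "is_interval I" and "I \<noteq> {}"
    and "regular_curve I \<alpha>"
    and "\<forall>s\<in>I. norm (vector_derivative \<alpha> (at s)) = 1"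
    and "\<forall>i\<in>{1..CARD('n) - 1}. \<forall>s\<in>I. curvature \<alpha> i s \<noteq> 0"
  shows "(\<forall>i\<in>{1..CARD('n) - 2}. (\<lambda>s. curvature \<alpha> (i + 1) s / curvature \<alpha> i s) constant_on I)
    \<longleftrightarrow>
    (\<exists>A (r :: nat \<Rightarrow> real) (m :: nat \<Rightarrow> real) (a :: real) (g :: real \<Rightarrow> real).
       orthogonal_matrix A \<and>
       (\<forall>i\<in>{1..CARD('n) div 2}. r i > 0) \<and>
       twisted (CARD('n) div 2) m \<and>
       g C1_differentiable_on I \<and> (\<forall>s\<in>I. deriv g s \<noteq> 0) \<and>
       (\<forall>s\<in>I. A *v frenet_frame \<alpha> 1 s = flat_torus_geodesic r a m (g s)))"
    (is "?ratios \<longleftrightarrow> (\<exists>A r m a g. ?torus A r m a g)")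
proof -
  let ?n = "CARD('n)"
  let ?\<kappa> = "\<lambda>i s. if i \<in> {1..<?n} then curvature \<alpha> i s else 0"
  interpret frenet_system I "frenet_frame \<alpha>" ?\<kappa>
    by (rule frenet_system_frenet_frame[OF assms])
  have dim: "DIM((real, 'n) vec) = ?n" by simp
  obtain s0 where s0: "s0 \<in> I" using assms(4) by blast
  show ?thesis
  proof
    assume ratios: ?ratios
    \<comment> \<open>The given quotients are those of consecutive curvatures; their products
      telescope to the quotient of k_i by k_1.\<close>
    have "i \<in> {1..<?n} \<Longrightarrow> \<exists>c. \<forall>s\<in>I. curvature \<alpha> i s = c * curvature \<alpha> 1 s" for i
    proof (induction i)
      case 0
      then show ?case by simp
    next
      case (Suc i)
      show ?case
      proof (cases "i = 0")
        case True
        then show ?thesis by (intro exI[of _ 1]) simp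
      next
        case False
        then obtain c where c: "\<forall>s\<in>I. curvature \<alpha> i s = c * curvature \<alpha> 1 s"
          using Suc by auto
        have "i \<in> {1..?n - 2}" "i \<in> {1..?n - 1}" using Suc.prems False by auto
        then have "(\<lambda>s. curvature \<alpha> (i + 1) s / curvature \<alpha> i s) constant_on I"
          and nonzero: "\<forall>s\<in>I. curvature \<alpha> i s \<noteq> 0"
          using ratios assms(7) by blast+
        then obtain d where "\<forall>s\<in>I. curvature \<alpha> (Suc i) s / curvature \<alpha> i s = d"
          by (auto simp: constant_on_def)
        with nonzero have "\<forall>s\<in>I. curvature \<alpha> (Suc i) s = (d * c) * curvature \<alpha> 1 s"
          using c by (simp add: divide_eq_eq)
        then show ?thesis by blast
      qed
    qed
    then obtain c where c: "\<And>i s. i \<in> {1..<?n} \<Longrightarrow> s \<in> I \<Longrightarrow> curvature \<alpha> i s = c i * curvature \<alpha> 1 s"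
      by metis
    interpret constant_ratios I "frenet_frame \<alpha>" ?\<kappa> "\<lambda>i. if i \<in> {1..<?n} then c i else 0"
    proof
      show "?\<kappa> i s = (if i \<in> {1..<?n} then c i else 0) * ?\<kappa> 1 s" if "s \<in> I" for i s
        using c[OF _ that, of i] assms(1) by simp
      show "(if i \<in> {1..<?n} then c i else 0) \<noteq> 0" if "i \<in> {1..<DIM((real, 'n) vec)}" for i
        using that c[OF _ s0, of i] kappa_nonzero[OF that s0] by auto
    qed simp_all
    obtain b :: "nat \<Rightarrow> (real, 'n) vec" and m r :: "nat \<Rightarrow> real" and a g where
      on: "\<And>i j. i \<in> {1..?n} \<Longrightarrow> j \<in> {1..?n} \<Longrightarrow> b i \<bullet> b j = (if i = j then 1 else 0)"
      and mr: "\<And>i. i \<in> {1..?n div 2} \<Longrightarrow> m i > 0 \<and> r i > 0"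
      and inj: "inj_on m {1..?n div 2}"
      and g: "\<And>s. s \<in> I \<Longrightarrow> (g has_real_derivative ?\<kappa> 1 s) (at s)"
      and planes: "\<And>s i. s \<in> I \<Longrightarrow> i \<in> {1..?n div 2} \<Longrightarrow>
        frenet_frame \<alpha> 1 s \<bullet> b (2 * i - 1) = r i * cos (m i * g s) \<and>
        frenet_frame \<alpha> 1 s \<bullet> b (2 * i) = r i * sin (m i * g s)"
      and last: "\<And>s. s \<in> I \<Longrightarrow> odd ?n \<Longrightarrow> frenet_frame \<alpha> 1 s \<bullet> b ?n = a"
      by (rule tangent_in_normal_form[unfolded dim]) (rule that)
    have "?torus (\<chi> p. b (pos p)) r m a g"
    proof (intro conjI ballI)
      show "orthogonal_matrix (\<chi> p. b (pos p))"
        unfolding orthogonal_matrix_rows using on by blast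
      show "r i > 0" if "i \<in> {1..?n div 2}" for i using mr[OF that] by blast
      \<comment> \<open>The normal form yields positive speeds, so distinct speeds have distinct
        absolute values.\<close>
      have "inj_on (\<lambda>i. \<bar>m i\<bar>) {1..?n div 2} \<longleftrightarrow> inj_on m {1..?n div 2}"
        using mr by (intro inj_on_cong) (simp add: abs_of_pos)
      moreover have "m i \<noteq> 0" if "i \<in> {1..?n div 2}" for i using mr[OF that] by simp
      ultimately show "twisted (?n div 2) m"
        unfolding twisted_def using inj by blast
      show "g C1_differentiable_on I"
        unfolding C1_differentiable_on_def
      proof (intro exI[of _ "?\<kappa> 1"] conjI ballI)
        show "(g has_vector_derivative ?\<kappa> 1 s) (at s)" if "s \<in> I" for s
          using g[OF that] unfolding has_real_derivative_iff_has_vector_derivative .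
        show "continuous_on I (?\<kappa> 1)" by (rule kappa_1_continuous)
      qed
      show "deriv g s \<noteq> 0" if "s \<in> I" for s
        using DERIV_imp_deriv[OF g[OF that]] kappa_nonzero[OF _ that, of 1] assms(1) by auto
      show "(\<chi> p :: 'n. b (pos p)) *v frenet_frame \<alpha> 1 s = flat_torus_geodesic r a m (g s)" if "s \<in> I" for s
        unfolding flat_torus_geodesic_iff using planes[OF that] last[OF that] by blast
    qed
    then show "\<exists>A r m a g. ?torus A r m a g" by blast
  next
    assume "\<exists>A r m a g. ?torus A r m a g"
    then obtain A r m a g where torus: "?torus A r m a g" by blast
    \<comment> \<open>The rows of \<open>A\<close>, numbered by position; \<open>inv pos\<close>
      undoes \<open>pos\<close> because \<open>pos\<close> is injective.\<close>
    define b where "b i = A $ inv pos i" for i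
    have "inj (pos :: 'n \<Rightarrow> nat)" by (simp add: inj_def pos_eq_iff)
    then have A: "A = (\<chi> p. b (pos p))" by (simp add: b_def vec_eq_iff)
    have on: "b i \<bullet> b j = (if i = j then 1 else 0)" if "i \<in> {1..?n}" "j \<in> {1..?n}" for i j
      using torus that unfolding A orthogonal_matrix_rows by blast
    have g: "(g has_real_derivative deriv g s) (at s)" if "s \<in> I" for s
    proof -
      have "g C1_differentiable_on I" using torus by blast
      then obtain D where "(g has_real_derivative D s) (at s)"
        using \<open>s \<in> I\<close> by (auto simp: C1_differentiable_on_def has_real_derivative_iff_has_vector_derivative)
      then show ?thesis by (simp add: DERIV_imp_deriv)
    qed
    have eq: "(\<forall>i\<in>{1..?n div 2}. frenet_frame \<alpha> 1 s \<bullet> b (2 * i - 1) = r i * cos (m i * g s) \<and>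
        frenet_frame \<alpha> 1 s \<bullet> b (2 * i) = r i * sin (m i * g s)) \<and>
      (odd ?n \<longrightarrow> frenet_frame \<alpha> 1 s \<bullet> b ?n = a)" if "s \<in> I" for s
      using torus that unfolding A flat_torus_geodesic_iff by blast
    show ?ratios
    proof
      fix i assume i: "i \<in> {1..?n - 2}"
      have "(\<lambda>s. ?\<kappa> (i + 1) s / ?\<kappa> i s) constant_on I"
      proof (rule constant_ratios_of_torus_curve[unfolded dim, OF on g _ _ _ i])
        fix s assume s: "s \<in> I"
        show "deriv g s \<noteq> 0" using torus s by blast
        show "frenet_frame \<alpha> 1 s \<bullet> b (2 * i - 1) = r i * cos (m i * g s) \<and>
            frenet_frame \<alpha> 1 s \<bullet> b (2 * i) = r i * sin (m i * g s)"
          if "i \<in> {1..?n div 2}" for i using eq[OF s] that by blast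
        show "frenet_frame \<alpha> 1 s \<bullet> b ?n = a" if "odd ?n" using eq[OF s] that by blast
      qed
      moreover have "i \<in> {1..<?n}" "i + 1 \<in> {1..<?n}" using i by auto
      ultimately show "(\<lambda>s. curvature \<alpha> (i + 1) s / curvature \<alpha> i s) constant_on I"
        by (simp only: if_True)
    qed
  qed
qed

end
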